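(* Let $\mathcal{D}$ be a triangulated category with shift $\Sigma$, and let $\mathbf{t}_1\le \mathbf{t}_2$ be $s$-torsion pairs in $\mathcal{D}$ such that $\mathbf{t}_2\le \Sigma^{-1}\mathbf{t}_1$. Let $V\in\mathcal{H}_{[\mathbf{t}_1,\mathbf{t}_2]}$ be such that $\overline{\mathrm{Gen}}_{\mathcal{H}_{[\mathbf{t}_1,\Sigma^{-1}\mathbf{t}_1]}}(V)\subseteq \mathcal{H}_{[\mathbf{t}_1,\mathbf{t}_2]}$. Then the following statements are equivalent. (a) $V$ is an extended tilting object in $\mathcal{H}_{[\mathbf{t}_1,\mathbf{t}_2]}$. (b) $V$ is a quasi-tilting object in $\mathcal{H}_{[\mathbf{t}_1,\Sigma^{-1}\mathbf{t}_1]}$ and $\overline{\mathrm{Gen}}_{\mathcal{H}_{[\mathbf{t}_1,\Sigma^{-1}\mathbf{t}_1]}}(V)=\mathcal{H}_{[\mathbf{t}_1,\mathbf{t}_2]}$. Moreover, if (a) or (b) holds, then $$V^{\perp_0}_{\mathcal{H}_{[\mathbf{t}_1,\Sigma^{-1}\mathbf{t}_1]}}=V^{\perp_0}_{\mathcal{H}_{[\mathbf{t}_1,\mathbf{t}_2]}}\star \mathcal{H}_{[\mathbf{t}_2,\Sigma^{-1}\mathbf{t}_1]}.$$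
   Context: Let $\mathcal{D}$ be a triangulated category with shift automorphism $\Sigma$. A full extension-closed subcategory $\mathcal{X}\subseteq\mathcal{D}$ (in particular $\mathcal{D}$ itself) is regarded as an extriangulated category with negative first extension: its $\mathfrak{s}$-conflations are the sequences $A\to B\to C$ with $A,B,C\in\mathcal{X}$ that are part of a distinguished triangle $A\to B\to C\to\Sigma A$; $\mathbb{E}(X,Y)=\mathbb{E}^1(X,Y)=\mathrm{Hom}_{\mathcal{D}}(X,\Sigma Y)$, $\mathbb{E}^0=\mathrm{Hom}_{\mathcal{D}}$ and $\mathbb{E}^{-1}(X,Y)=\mathrm{Hom}_{\mathcal{D}}(X,\Sigma^{-1}Y)$. For classes $\mathcal{A},\mathcal{B}$, $\mathcal{A}\star\mathcal{B}$ is the class of objects $C$ admitting an $\mathfrak{s}$-conflation $A\to C\to B$ with $A\in\mathcal{A}$, $B\in\mathcal{B}$. An $s$-torsion pair in $\mathcal{X}$ is a pair $\mathbf{t}=(\mathcal{T},\mathcal{F})$ of full isomorphism-closed subcategories of $\mathcal{X}$ with $\mathrm{Hom}(\mathcal{T},\mathcal{F})=0$, $\mathbb{E}^{-1}(\mathcal{T},\mathcal{F})=0$ and $\mathcal{X}=\mathcal{T}\star\mathcal{F}$ (conflations taken in $\mathcal{X}$). The set of them is $\mathsf{stors}\,\mathcal{X}$, ordered by $(\mathcal{T},\mathcal{F})\le(\mathcal{T}',\mathcal{F}')$ iff $\mathcal{T}\subseteq\mathcal{T}'$. For $\mathbf{t}=(\mathcal{T},\mathcal{F})\in\mathsf{stors}\,\mathcal{D}$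 and $k\in\mathbb{Z}$, $\Sigma^{k}\mathbf{t}=(\Sigma^k\mathcal{T},\Sigma^k\mathcal{F})\in\mathsf{stors}\,\mathcal{D}$. For $\mathbf{t}_1=(\mathcal{T}_1,\mathcal{F}_1)\le\mathbf{t}_2=(\mathcal{T}_2,\mathcal{F}_2)$ in $\mathsf{stors}\,\mathcal{D}$, the heart of the interval $[\mathbf{t}_1,\mathbf{t}_2]$ is the extension-closed subcategory $\mathcal{H}_{[\mathbf{t}_1,\mathbf{t}_2]}=\mathcal{F}_1\cap\mathcal{T}_2$. Let $\mathcal{X}$ be an extriangulated category with negative first extension and $V\in\mathcal{X}$. - $V^{\perp_i}=V^{\perp_i}_{\mathcal{X}}=\{X\in\mathcal{X}:\mathbb{E}^i(V,X)=0\}$ for $i\in\{-1,0,1\}$. - $\mathrm{Gen}(V)=\mathrm{Gen}_{\mathcal{X}}(V)$ is the class of $X\in\mathcal{X}$ such that $X=0$ or there is an $\mathfrak{s}$-conflation $A\to\coprod_\alpha V\xrightarrow{f}X$ in $\mathcal{X}$ for some set $\alpha$ (for which the coproduct exists in $\mathcal{X}$) with $f\ne0$. - $\mathrm{Pres}(V)=\mathrm{Pres}_{\mathcal{X}}(V)$ is the class of $X\in\mathcal{X}$ such that $X=0$ or there is such a conflation with moreover $A\in\mathrm{Gen}(V)$. - $\overline{\mathrm{Gen}}_{\mathcal{X}}(V)$ is the class of $X\in\mathcal{X}$ admitting an $\mathfrak{s}$-conflation $X\to V_0\to X'$ in $\mathcal{X}$ with $V_0\in\mathrm{Gen}_{\mathcal{X}}(V)$.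 - A class $\mathcal{S}\subseteq\mathcal{X}$ is cogenerating in $\mathcal{X}$ if every $X\in\mathcal{X}$ admits an $\mathfrak{s}$-conflation $X\to S\to X'$ in $\mathcal{X}$ with $S\in\mathcal{S}$. - $V$ is extended tilting in $\mathcal{X}$ if (T1) $(\mathrm{Gen}(V),V^{\perp_0})\in\mathsf{stors}\,\mathcal{X}$; (T2) $\mathrm{Gen}(V)=\mathrm{Pres}(V)$ and $\mathrm{Gen}(V)\subseteq V^{\perp_1}$; (T3) $\mathrm{Gen}(V)$ is a cogenerating class in $\mathcal{X}$. - $V$ is quasi-tilting in $\mathcal{X}$ if (T1) holds and $\mathrm{Gen}(V)=\mathrm{Pres}(V)=\overline{\mathrm{Gen}}_{\mathcal{X}}(V)\cap V^{\perp_1}$. *)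

theory Defs
  imports "HOL-Algebra.Group"
begin

section \<open>Additive categories\<close>

record ('o, 'm) category =
  Obj :: "'o set"
  Hom :: "'o \<Rightarrow> 'o \<Rightarrow> 'm set"
  Ide :: "'o \<Rightarrow> 'm"
  Comp :: "'m \<Rightarrow> 'm \<Rightarrow> 'm" (infixl "\<bullet>\<index>" 70)

locale category =
  fixes D (structure)
  assumes Hom_disjoint:
      "\<lbrakk>A \<in> Obj D; B \<in> Obj D; A' \<in> Obj D; B' \<in> Obj D; f \<in> Hom D A B; f \<in> Hom D A' B'\<rbrakk>
        \<Longrightarrow> A = A' \<and> B = B'"
    and Id_in_Hom: "A \<in> Obj D \<Longrightarrow> Ide D A \<in> Hom D A A"
    and Comp_in_Hom:
      "\<lbrakk>A \<in> Obj D; B \<in> Obj D; C \<in> Obj D; f \<in> Hom D A B; g \<in> Hom D B C\<rbrakk>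
        \<Longrightarrow> g \<bullet> f \<in> Hom D A C"
    and Comp_Id: "\<lbrakk>A \<in> Obj D; B \<in> Obj D; f \<in> Hom D A B\<rbrakk> \<Longrightarrow> f \<bullet> Ide D A = f"
    and Id_Comp: "\<lbrakk>A \<in> Obj D; B \<in> Obj D; f \<in> Hom D A B\<rbrakk> \<Longrightarrow> Ide D B \<bullet> f = f"
    and Comp_assoc:
      "\<lbrakk>A \<in> Obj D; B \<in> Obj D; C \<in> Obj D; E \<in> Obj D;
        f \<in> Hom D A B; g \<in> Hom D B C; h \<in> Hom D C E\<rbrakk>
        \<Longrightarrow> h \<bullet> (g \<bullet> f) = (h \<bullet> g) \<bullet> f"

definition isomorphism :: "('o, 'm, 'z) category_scheme \<Rightarrow> 'o \<Rightarrow> 'o \<Rightarrow> 'm \<Rightarrow> bool" where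
  "isomorphism D A B f \<longleftrightarrow> f \<in> Hom D A B \<and>
     (\<exists>g \<in> Hom D B A. g \<bullet>\<^bsub>D\<^esub> f = Ide D A \<and> f \<bullet>\<^bsub>D\<^esub> g = Ide D B)"

definition isomorphic :: "('o, 'm, 'z) category_scheme \<Rightarrow> 'o \<Rightarrow> 'o \<Rightarrow> bool" where
  "isomorphic D A B \<longleftrightarrow> (\<exists>f. isomorphism D A B f)"

definition zero_object :: "('o, 'm, 'z) category_scheme \<Rightarrow> 'o \<Rightarrow> bool" where
  "zero_object D Z \<longleftrightarrow> Z \<in> Obj D \<and>
     (\<forall>A \<in> Obj D. (\<exists>!f. f \<in> Hom D Z A) \<and> (\<exists>!f. f \<in> Hom D A Z))"

text \<open>
  \<open>P\<close> with injections \<open>\<iota>\<close> is a coproduct of the family \<open>W\<close> over \<open>\<alpha>\<close> in the full subcategory of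
  \<open>D\<close> on the class of objects \<open>\<X>\<close>; the universal property is tested against objects of
  \<open>\<X>\<close> only.
\<close>

definition is_coproduct ::
  "('o, 'm, 'z) category_scheme \<Rightarrow> 'o set \<Rightarrow> 'i set \<Rightarrow> ('i \<Rightarrow> 'o) \<Rightarrow> 'o \<Rightarrow> ('i \<Rightarrow> 'm) \<Rightarrow> bool" where
  "is_coproduct D \<X> \<alpha> W P \<iota> \<longleftrightarrow> P \<in> \<X> \<and> (\<forall>i \<in> \<alpha>. W i \<in> \<X> \<and> \<iota> i \<in> Hom D (W i) P) \<and>
     (\<forall>Y \<in> \<X>. \<forall>g. (\<forall>i \<in> \<alpha>. g i \<in> Hom D (W i) Y) \<longrightarrow>
        (\<exists>!u. u \<in> Hom D P Y \<and> (\<forall>i \<in> \<alpha>. u \<bullet>\<^bsub>D\<^esub> \<iota> i = g i)))"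

record ('o, 'm) additive_category = "('o, 'm) category" +
  Zero :: "'o \<Rightarrow> 'o \<Rightarrow> 'm"
  Add :: "'m \<Rightarrow> 'm \<Rightarrow> 'm"

definition hom_group ::
  "('o, 'm, 'z) additive_category_scheme \<Rightarrow> 'o \<Rightarrow> 'o \<Rightarrow> 'm monoid" where
  "hom_group D A B = \<lparr>carrier = Hom D A B, mult = Add D, one = Zero D A B\<rparr>"

definition Neg :: "('o, 'm, 'z) additive_category_scheme \<Rightarrow> 'o \<Rightarrow> 'o \<Rightarrow> 'm \<Rightarrow> 'm" where
  "Neg D A B f = inv\<^bsub>hom_group D A B\<^esub> f"

locale additive_category = category D for D (structure) +
  assumes comm_group_hom: "\<lbrakk>A \<in> Obj D; B \<in> Obj D\<rbrakk> \<Longrightarrow> comm_group (hom_group D A B)"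
    and Comp_Add:
      "\<lbrakk>A \<in> Obj D; B \<in> Obj D; C \<in> Obj D; f \<in> Hom D A B; f' \<in> Hom D A B; g \<in> Hom D B C\<rbrakk>
        \<Longrightarrow> g \<bullet> Add D f f' = Add D (g \<bullet> f) (g \<bullet> f')"
    and Add_Comp:
      "\<lbrakk>A \<in> Obj D; B \<in> Obj D; C \<in> Obj D; f \<in> Hom D A B; g \<in> Hom D B C; g' \<in> Hom D B C\<rbrakk>
        \<Longrightarrow> Add D g g' \<bullet> f = Add D (g \<bullet> f) (g' \<bullet> f)"
    and ex_zero_object: "\<exists>Z. zero_object D Z"
    and ex_biproduct:
      "\<lbrakk>A \<in> Obj D; B \<in> Obj D\<rbrakk> \<Longrightarrow>
        \<exists>P \<in> Obj D. \<exists>i \<in> Hom D A P. \<exists>j \<in> Hom D B P. \<exists>p \<in> Hom D P A. \<exists>q \<in> Hom D P B.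
          p \<bullet> i = Ide D A \<and> q \<bullet> j = Ide D B \<and> p \<bullet> j = Zero D B A \<and> q \<bullet> i = Zero D A B \<and>
          Add D (i \<bullet> p) (j \<bullet> q) = Ide D P"

section \<open>Triangulated categories\<close>

text \<open>
  \<open>Sh\<close> and \<open>Shm\<close> are the shift on objects and on morphisms, and \<open>Tri D A B C f g h\<close> says
  that \<open>A \<rightarrow> B \<rightarrow> C \<rightarrow> Sh A\<close> (with maps \<open>f\<close>, \<open>g\<close>, \<open>h\<close>) is a distinguished triangle.
\<close>

record ('o, 'm) triangulated_category = "('o, 'm) additive_category" +
  Sh :: "'o \<Rightarrow> 'o"
  Shm :: "'m \<Rightarrow> 'm"
  Tri :: "'o \<Rightarrow> 'o \<Rightarrow> 'o \<Rightarrow> 'm \<Rightarrow> 'm \<Rightarrow> 'm \<Rightarrow> bool"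

locale triangulated_category = additive_category D
  for D :: "('o, 'm, 'z) triangulated_category_scheme" (structure) +
  assumes bij_Sh: "bij_betw (Sh D) (Obj D) (Obj D)"
    and bij_Shm:
      "\<lbrakk>A \<in> Obj D; B \<in> Obj D\<rbrakk> \<Longrightarrow> bij_betw (Shm D) (Hom D A B) (Hom D (Sh D A) (Sh D B))"
    and Shm_Id: "A \<in> Obj D \<Longrightarrow> Shm D (Ide D A) = Ide D (Sh D A)"
    and Shm_Comp:
      "\<lbrakk>A \<in> Obj D; B \<in> Obj D; C \<in> Obj D; f \<in> Hom D A B; g \<in> Hom D B C\<rbrakk>
        \<Longrightarrow> Shm D (g \<bullet> f) = Shm D g \<bullet> Shm D f"
    and Shm_Add:
      "\<lbrakk>A \<in> Obj D; B \<in> Obj D; f \<in> Hom D A B; f' \<in> Hom D A B\<rbrakk>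
        \<Longrightarrow> Shm D (Add D f f') = Add D (Shm D f) (Shm D f')"
    and Tri_typed:
      "Tri D A B C f g h \<Longrightarrow> A \<in> Obj D \<and> B \<in> Obj D \<and> C \<in> Obj D \<and>
        f \<in> Hom D A B \<and> g \<in> Hom D B C \<and> h \<in> Hom D C (Sh D A)"
    and Tri_iso:
      "\<lbrakk>Tri D A B C f g h; A' \<in> Obj D; B' \<in> Obj D; C' \<in> Obj D;
        f' \<in> Hom D A' B'; g' \<in> Hom D B' C'; h' \<in> Hom D C' (Sh D A');
        isomorphism D A A' a; isomorphism D B B' b; isomorphism D C C' c;
        b \<bullet> f = f' \<bullet> a; c \<bullet> g = g' \<bullet> b; Shm D a \<bullet> h = h' \<bullet> c\<rbrakk>
        \<Longrightarrow> Tri D A' B' C' f' g' h'"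
    and Tri_Id:
      "\<lbrakk>A \<in> Obj D; zero_object D Z\<rbrakk> \<Longrightarrow>
        Tri D A A Z (Ide D A) (Zero D A Z) (Zero D Z (Sh D A))"
    and Tri_ex:
      "\<lbrakk>A \<in> Obj D; B \<in> Obj D; f \<in> Hom D A B\<rbrakk> \<Longrightarrow> \<exists>C g h. Tri D A B C f g h"
    and Tri_rotate:
      "\<lbrakk>A \<in> Obj D; B \<in> Obj D; C \<in> Obj D; f \<in> Hom D A B; g \<in> Hom D B C; h \<in> Hom D C (Sh D A)\<rbrakk>
        \<Longrightarrow> Tri D A B C f g h \<longleftrightarrow> Tri D B C (Sh D A) g h (Neg D (Sh D A) (Sh D B) (Shm D f))"
    and Tri_complete:
      "\<lbrakk>Tri D A B C f g h; Tri D A' B' C' f' g' h'; a \<in> Hom D A A'; b \<in> Hom D B B';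
        b \<bullet> f = f' \<bullet> a\<rbrakk>
        \<Longrightarrow> \<exists>c \<in> Hom D C C'. c \<bullet> g = g' \<bullet> b \<and> Shm D a \<bullet> h = h' \<bullet> c"
    and Tri_octahedral:
      "\<lbrakk>Tri D A B C' f u u'; Tri D B C A' g v v'; Tri D A C B' (g \<bullet> f) w w'\<rbrakk>
        \<Longrightarrow> \<exists>a \<in> Hom D C' B'. \<exists>b \<in> Hom D B' A'. Tri D C' B' A' a b (Shm D u \<bullet> v') \<and>
          a \<bullet> u = w \<bullet> g \<and> w' \<bullet> a = u' \<and> b \<bullet> w = v \<and> v' \<bullet> b = Shm D f \<bullet> w'"

definition shift_pow :: "('o, 'm, 'z) triangulated_category_scheme \<Rightarrow> int \<Rightarrow> 'o \<Rightarrow> 'o" where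
  "shift_pow D k = (if 0 \<le> k then Sh D ^^ nat k else inv_into (Obj D) (Sh D) ^^ nat (- k))"

section \<open>Extension-closed subcategories as extriangulated categories\<close>

text \<open>
  A full subcategory is given by its class \<open>\<X>\<close> of objects.  The definitions below make
  sense for every \<open>\<X>\<close>, and are used for extension-closed ones.
\<close>

definition conflation ::
  "('o, 'm, 'z) triangulated_category_scheme \<Rightarrow> 'o set \<Rightarrow> 'o \<Rightarrow> 'o \<Rightarrow> 'o \<Rightarrow> 'm \<Rightarrow> 'm \<Rightarrow> bool" where
  "conflation D \<X> A B C f g \<longleftrightarrow> A \<in> \<X> \<and> B \<in> \<X> \<and> C \<in> \<X> \<and> (\<exists>h. Tri D A B C f g h)"

definition star ::
  "('o, 'm, 'z) triangulated_category_scheme \<Rightarrow> 'o set \<Rightarrow> 'o set \<Rightarrow> 'o set \<Rightarrow> 'o set" where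
  "star D \<X> \<A> \<B> = {C. \<exists>A \<in> \<A>. \<exists>B \<in> \<B>. \<exists>f g. conflation D \<X> A C B f g}"

definition Ext_zero ::
  "('o, 'm, 'z) triangulated_category_scheme \<Rightarrow> int \<Rightarrow> 'o \<Rightarrow> 'o \<Rightarrow> bool" where
  "Ext_zero D i X Y \<longleftrightarrow> Hom D X (shift_pow D i Y) = {Zero D X (shift_pow D i Y)}"

section \<open>Torsion pairs and hearts\<close>

definition iso_closed_in ::
  "('o, 'm, 'z) triangulated_category_scheme \<Rightarrow> 'o set \<Rightarrow> 'o set \<Rightarrow> bool" where
  "iso_closed_in D \<X> \<S> \<longleftrightarrow> \<S> \<subseteq> \<X> \<and> (\<forall>A \<in> \<S>. \<forall>B \<in> \<X>. isomorphic D A B \<longrightarrow> B \<in> \<S>)"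

definition stors ::
  "('o, 'm, 'z) triangulated_category_scheme \<Rightarrow> 'o set \<Rightarrow> ('o set \<times> 'o set) set" where
  "stors D \<X> = {(\<T>, \<F>). iso_closed_in D \<X> \<T> \<and> iso_closed_in D \<X> \<F> \<and>
     (\<forall>A \<in> \<T>. \<forall>B \<in> \<F>. Ext_zero D 0 A B) \<and>
     (\<forall>A \<in> \<T>. \<forall>B \<in> \<F>. Ext_zero D (-1) A B) \<and>
     \<X> = star D \<X> \<T> \<F>}"

definition tors_le :: "'o set \<times> 'o set \<Rightarrow> 'o set \<times> 'o set \<Rightarrow> bool" where
  "tors_le t t' \<longleftrightarrow> fst t \<subseteq> fst t'"

definition tors_shift ::
  "('o, 'm, 'z) triangulated_category_scheme \<Rightarrow> int \<Rightarrow> 'o set \<times> 'o set \<Rightarrow> 'o set \<times> 'o set" where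
  "tors_shift D k t = (shift_pow D k ` fst t, shift_pow D k ` snd t)"

definition heart :: "'o set \<times> 'o set \<Rightarrow> 'o set \<times> 'o set \<Rightarrow> 'o set" where
  "heart t t' = snd t \<inter> fst t'"

section \<open>Extended tilting and quasi-tilting objects\<close>

definition perp ::
  "('o, 'm, 'z) triangulated_category_scheme \<Rightarrow> 'o set \<Rightarrow> int \<Rightarrow> 'o \<Rightarrow> 'o set" where
  "perp D \<X> i V = {X \<in> \<X>. Ext_zero D i V X}"

text \<open>
  \<open>copower_conflation D \<X> V A X\<close>: there is a conflation in \<open>\<X>\<close> from \<open>A\<close> via a
  coproduct of copies of \<open>V\<close> to \<open>X\<close> whose second map is nonzero.  Index sets are
  taken to be sets of morphisms.  This is no restriction: the second map can only be nonzero if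
  \<open>V\<close> is not a zero object, and then a coproduct of copies of \<open>V\<close> over any set is also one
  over its set of injections, by the lemma \<open>copower_reindex\<close> below.
\<close>

definition copower_conflation ::
  "('o, 'm, 'z) triangulated_category_scheme \<Rightarrow> 'o set \<Rightarrow> 'o \<Rightarrow> 'o \<Rightarrow> 'o \<Rightarrow> bool" where
  "copower_conflation D \<X> V A X \<longleftrightarrow> (\<exists>(\<alpha> :: 'm set) P \<iota> k f.
     is_coproduct D \<X> \<alpha> (\<lambda>_. V) P \<iota> \<and> conflation D \<X> A P X k f \<and> f \<noteq> Zero D P X)"

definition Gen :: "('o, 'm, 'z) triangulated_category_scheme \<Rightarrow> 'o set \<Rightarrow> 'o \<Rightarrow> 'o set" where
  "Gen D \<X> V = {X \<in> \<X>. zero_object D X \<or> (\<exists>A. copower_conflation D \<X> V A X)}"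

definition Pres :: "('o, 'm, 'z) triangulated_category_scheme \<Rightarrow> 'o set \<Rightarrow> 'o \<Rightarrow> 'o set" where
  "Pres D \<X> V = {X \<in> \<X>. zero_object D X \<or> (\<exists>A \<in> Gen D \<X> V. copower_conflation D \<X> V A X)}"

definition Gen_bar :: "('o, 'm, 'z) triangulated_category_scheme \<Rightarrow> 'o set \<Rightarrow> 'o \<Rightarrow> 'o set" where
  "Gen_bar D \<X> V = {X \<in> \<X>. \<exists>V\<^sub>0 \<in> Gen D \<X> V. \<exists>X' f g. conflation D \<X> X V\<^sub>0 X' f g}"

definition cogenerating ::
  "('o, 'm, 'z) triangulated_category_scheme \<Rightarrow> 'o set \<Rightarrow> 'o set \<Rightarrow> bool" where
  "cogenerating D \<X> \<S> \<longleftrightarrow> \<S> \<subseteq> \<X> \<and>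
     (\<forall>X \<in> \<X>. \<exists>S \<in> \<S>. \<exists>X' f g. conflation D \<X> X S X' f g)"

definition extended_tilting ::
  "('o, 'm, 'z) triangulated_category_scheme \<Rightarrow> 'o set \<Rightarrow> 'o \<Rightarrow> bool" where
  "extended_tilting D \<X> V \<longleftrightarrow> V \<in> \<X> \<and>
     (Gen D \<X> V, perp D \<X> 0 V) \<in> stors D \<X> \<and>
     Gen D \<X> V = Pres D \<X> V \<and> Gen D \<X> V \<subseteq> perp D \<X> 1 V \<and>
     cogenerating D \<X> (Gen D \<X> V)"

definition quasi_tilting ::
  "('o, 'm, 'z) triangulated_category_scheme \<Rightarrow> 'o set \<Rightarrow> 'o \<Rightarrow> bool" where
  "quasi_tilting D \<X> V \<longleftrightarrow> V \<in> \<X> \<and>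
     (Gen D \<X> V, perp D \<X> 0 V) \<in> stors D \<X> \<and>
     Gen D \<X> V = Pres D \<X> V \<and> Pres D \<X> V = Gen_bar D \<X> V \<inter> perp D \<X> 1 V"

lemma (in additive_category) Zero_in_Hom:
  assumes "A \<in> Obj D" "B \<in> Obj D"
  shows "Zero D A B \<in> Hom D A B"
proof -
  interpret G: comm_group "hom_group D A B" by (rule comm_group_hom[OF assms])
  show ?thesis using G.one_closed by (simp add: hom_group_def)
qed

lemma (in additive_category) zero_objectI:
  assumes V: "V \<in> Obj D" and eq: "Ide D V = Zero D V V"
  shows "zero_object D V"
proof -
  have cancel: "x = Zero D A B"
    if "A \<in> Obj D" "B \<in> Obj D" "x \<in> Hom D A B" "Add D x x = x" for A B x
  proof -
    interpret G: comm_group "hom_group D A B" by (rule comm_group_hom[OF that(1,2)])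
    show ?thesis using G.l_cancel_one[of x x] that by (simp add: hom_group_def)
  qed
  have idem: "Add D (Ide D V) (Ide D V) = Ide D V"
  proof -
    interpret G: comm_group "hom_group D V V" by (rule comm_group_hom[OF V V])
    show ?thesis using G.l_one[OF G.one_closed] by (simp add: hom_group_def eq)
  qed
  have "f = Zero D V A" if "A \<in> Obj D" "f \<in> Hom D V A" for A f
  proof (rule cancel[OF V that])
    show "Add D f f = f"
      using Comp_Add[OF V V that(1) Id_in_Hom[OF V] Id_in_Hom[OF V] that(2)] idem
        Comp_Id[OF V that] by simp
  qed
  moreover have "f = Zero D A V" if "A \<in> Obj D" "f \<in> Hom D A V" for A f
  proof (rule cancel[OF that(1) V that(2)])
    show "Add D f f = f"
      using Add_Comp[OF that(1) V V that(2) Id_in_Hom[OF V] Id_in_Hom[OF V]] idem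
        Id_Comp[OF that(1) V that(2)] by simp
  qed
  ultimately show ?thesis
    unfolding zero_object_def using V Zero_in_Hom by blast
qed

lemma (in additive_category) copower_reindex:
  fixes \<alpha> :: "'i set"
  assumes cop: "is_coproduct D \<X> \<alpha> (\<lambda>_. V) P \<iota>" and V: "V \<in> \<X>" "\<X> \<subseteq> Obj D"
    and nz: "\<not> zero_object D V"
  shows "inj_on \<iota> \<alpha>" and "is_coproduct D \<X> (\<iota> ` \<alpha>) (\<lambda>_. V) P (\<lambda>m. m)"
proof -
  have VO: "V \<in> Obj D" using V by auto
  have univ: "\<exists>!u. u \<in> Hom D P Y \<and> (\<forall>i \<in> \<alpha>. u \<bullet> \<iota> i = g i)"
    if "Y \<in> \<X>" "\<forall>i \<in> \<alpha>. g i \<in> Hom D V Y" for Y g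
    using cop that by (simp add: is_coproduct_def)
  show "inj_on \<iota> \<alpha>"
  proof (rule inj_onI, rule ccontr)
    fix i j assume ij: "i \<in> \<alpha>" "j \<in> \<alpha>" "\<iota> i = \<iota> j" "i \<noteq> j"
    define g where "g l = (if l = i then Ide D V else Zero D V V)" for l
    have g: "\<forall>l \<in> \<alpha>. g l \<in> Hom D V V"
      using Zero_in_Hom[OF VO VO] Id_in_Hom[OF VO] by (simp add: g_def)
    obtain u where u: "\<forall>l \<in> \<alpha>. u \<bullet> \<iota> l = g l"
      using ex1_implies_ex[OF univ[OF V(1) g]] by blast
    have "g i = g j" using bspec[OF u ij(1)] bspec[OF u ij(2)] ij(3) by simp
    then have "Ide D V = Zero D V V" using ij(4) by (simp add: g_def)
    then show False using zero_objectI[OF VO] nz by simp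
  qed
  have img: "\<exists>!u. u \<in> Hom D P Y \<and> (\<forall>m \<in> \<iota> ` \<alpha>. u \<bullet> m = g m)"
    if "Y \<in> \<X>" "\<forall>m \<in> \<iota> ` \<alpha>. g m \<in> Hom D V Y" for Y g
    using univ[of Y "\<lambda>i. g (\<iota> i)"] that by simp
  have "P \<in> \<X>" "\<forall>i \<in> \<alpha>. \<iota> i \<in> Hom D V P"
    using cop by (simp_all add: is_coproduct_def)
  then have inj: "\<forall>m \<in> \<iota> ` \<alpha>. V \<in> \<X> \<and> m \<in> Hom D V P" using V(1) by simp
  show "is_coproduct D \<X> (\<iota> ` \<alpha>) (\<lambda>_. V) P (\<lambda>m. m)"
    unfolding is_coproduct_def
    by (intro conjI[OF \<open>P \<in> \<X>\<close> conjI[OF inj]] ballI allI impI) (rule img)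
qed

end

theory Submission
  imports Defs
begin

text \<open>
  Everything takes place in the heart \<open>\<A>\<close> of \<open>[t\<^sub>1, \<Sigma>\<^sup>-\<^sup>1 t\<^sub>1]\<close>, where there are no nonzero maps from a
  shifted object to an unshifted one, so conflations behave like short exact sequences.  In it
  \<open>\<H> = \<F>\<^sub>1 \<inter> \<T>\<^sub>2\<close> is a torsion class: it is closed under quotients, and copowers of \<open>V\<close> in
  \<open>\<H>\<close> and in \<open>\<A>\<close> agree.  Kernels of maps from copowers of \<open>V\<close> lie in
  \<open>Gen_bar\<close>, hence in \<open>\<H>\<close> by hypothesis, so \<open>Gen\<close>, \<open>Pres\<close> and \<open>Gen_bar\<close> do not depend on
  which of the two hearts is used.  For the remaining inclusion of \<open>Gen_bar \<inter> perp 1\<close> in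
  \<open>Gen\<close>, take conflations \<open>X \<rightarrow> V\<^sub>0 \<rightarrow> X'\<close> and \<open>K \<rightarrow> P \<rightarrow> X'\<close> with \<open>V\<^sub>0\<close> and \<open>K\<close> in \<open>Gen\<close> and
  \<open>P\<close> a copower of \<open>V\<close>.  As \<open>P \<rightarrow> X'\<close> lifts to \<open>V\<^sub>0\<close>, the connecting map \<open>X' \<rightarrow> \<Sigma>X\<close>
  factors through \<open>\<Sigma>K\<close>; its composite with the shift of a map \<open>X \<rightarrow> Y\<close>, \<open>Y\<close> in
  \<open>perp 0\<close>, therefore vanishes, so that map extends to \<open>V\<^sub>0\<close> and is zero.
\<close>

section \<open>Zero morphisms, negatives and vanishing Hom groups in additive categories\<close>

context additive_category
begin

lemma Zero_unique:
  assumes "A \<in> Obj D" "B \<in> Obj D" "x \<in> Hom D A B" "y \<in> Hom D A B" "Add D x y = y"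
  shows "x = Zero D A B"
proof -
  interpret G: comm_group "hom_group D A B" by (rule comm_group_hom[OF assms(1,2)])
  show ?thesis using G.r_cancel_one[of y x] assms by (simp add: hom_group_def)
qed

lemma Add_Zero:
  assumes "A \<in> Obj D" "B \<in> Obj D" "x \<in> Hom D A B"
  shows "Add D (Zero D A B) x = x"
proof -
  interpret G: comm_group "hom_group D A B" by (rule comm_group_hom[OF assms(1,2)])
  show ?thesis using G.l_one[of x] assms by (simp add: hom_group_def)
qed

lemma ex_difference:
  assumes "A \<in> Obj D" "B \<in> Obj D" "x \<in> Hom D A B" "y \<in> Hom D A B"
  shows "\<exists>d \<in> Hom D A B. x = Add D d y"
proof -
  interpret G: comm_group "hom_group D A B" by (rule comm_group_hom[OF assms(1,2)])
  let ?d = "x \<otimes>\<^bsub>hom_group D A B\<^esub> inv\<^bsub>hom_group D A B\<^esub> y"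
  have xy: "x \<in> carrier (hom_group D A B)" "y \<in> carrier (hom_group D A B)"
    using assms by (simp_all add: hom_group_def)
  have "x = ?d \<otimes>\<^bsub>hom_group D A B\<^esub> y"
    using xy by (simp add: G.m_assoc)
  moreover have "?d \<in> carrier (hom_group D A B)" using xy by simp
  ultimately show ?thesis by (auto simp: hom_group_def)
qed

lemma Neg_in_Hom:
  assumes "A \<in> Obj D" "B \<in> Obj D" "x \<in> Hom D A B"
  shows "Neg D A B x \<in> Hom D A B"
proof -
  interpret G: comm_group "hom_group D A B" by (rule comm_group_hom[OF assms(1,2)])
  show ?thesis using G.inv_closed[of x] assms by (simp add: hom_group_def Neg_def)
qed

lemma Neg_inject:
  assumes "A \<in> Obj D" "B \<in> Obj D" "x \<in> Hom D A B" "y \<in> Hom D A B"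
    "Neg D A B x = Neg D A B y"
  shows "x = y"
proof -
  interpret G: comm_group "hom_group D A B" by (rule comm_group_hom[OF assms(1,2)])
  show ?thesis using G.inv_inj assms by (auto simp: hom_group_def Neg_def inj_on_def)
qed

lemma Add_Neg:
  assumes "A \<in> Obj D" "B \<in> Obj D" "x \<in> Hom D A B"
  shows "Add D (Neg D A B x) x = Zero D A B"
proof -
  interpret G: comm_group "hom_group D A B" by (rule comm_group_hom[OF assms(1,2)])
  show ?thesis using G.l_inv[of x] assms by (simp add: hom_group_def Neg_def)
qed

lemma Neg_unique:
  assumes "A \<in> Obj D" "B \<in> Obj D" "x \<in> Hom D A B" "y \<in> Hom D A B"
    "Add D y x = Zero D A B"
  shows "y = Neg D A B x"
proof -
  interpret G: comm_group "hom_group D A B" by (rule comm_group_hom[OF assms(1,2)])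
  show ?thesis using G.inv_equality[of y x] assms by (simp add: hom_group_def Neg_def)
qed

lemma Neg_Zero:
  assumes "A \<in> Obj D" "B \<in> Obj D"
  shows "Neg D A B (Zero D A B) = Zero D A B"
  using Neg_unique[OF assms] Zero_in_Hom[OF assms] Add_Zero[OF assms] by metis

lemma Comp_Zero:
  assumes "A \<in> Obj D" "B \<in> Obj D" "C \<in> Obj D" "g \<in> Hom D B C"
  shows "g \<bullet> Zero D A B = Zero D A C"
proof -
  note z = Zero_in_Hom[OF assms(1,2)]
  have "Add D (g \<bullet> Zero D A B) (g \<bullet> Zero D A B) = g \<bullet> Zero D A B"
    using Comp_Add[OF assms(1-3) z z assms(4)] Add_Zero[OF assms(1,2) z] by simp
  with Zero_unique[OF assms(1,3)] Comp_in_Hom[OF assms(1-3) z assms(4)] show ?thesis by blast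
qed

lemma Zero_Comp:
  assumes "A \<in> Obj D" "B \<in> Obj D" "C \<in> Obj D" "f \<in> Hom D A B"
  shows "Zero D B C \<bullet> f = Zero D A C"
proof -
  note z = Zero_in_Hom[OF assms(2,3)]
  have "Add D (Zero D B C \<bullet> f) (Zero D B C \<bullet> f) = Zero D B C \<bullet> f"
    using Add_Comp[OF assms(1-4) z z] Add_Zero[OF assms(2,3) z] by simp
  with Zero_unique[OF assms(1,3)] Comp_in_Hom[OF assms(1-4) z] show ?thesis by blast
qed

lemma Neg_Comp:
  assumes "A \<in> Obj D" "B \<in> Obj D" "C \<in> Obj D" "f \<in> Hom D A B" "g \<in> Hom D B C"
  shows "Neg D B C g \<bullet> f = Neg D A C (g \<bullet> f)"
proof -
  note n = Neg_in_Hom[OF assms(2,3,5)]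
  have "Add D (Neg D B C g \<bullet> f) (g \<bullet> f) = Zero D A C"
    using Add_Comp[OF assms(1-4) n assms(5)] Add_Neg[OF assms(2,3,5)] Zero_Comp[OF assms(1-4)]
    by simp
  with Neg_unique[OF assms(1,3)] Comp_in_Hom[OF assms(1-4)] n assms(5) show ?thesis by blast
qed

lemma Comp_Neg:
  assumes "A \<in> Obj D" "B \<in> Obj D" "C \<in> Obj D" "f \<in> Hom D A B" "g \<in> Hom D B C"
  shows "g \<bullet> Neg D A B f = Neg D A C (g \<bullet> f)"
proof -
  note n = Neg_in_Hom[OF assms(1,2,4)]
  have "Add D (g \<bullet> Neg D A B f) (g \<bullet> f) = Zero D A C"
    using Comp_Add[OF assms(1-3) n assms(4,5)] Add_Neg[OF assms(1,2,4)] Comp_Zero[OF assms(1-3,5)]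
    by simp
  with Neg_unique[OF assms(1,3)] Comp_in_Hom[OF assms(1-3) _ assms(5)] n assms(4)
  show ?thesis by blast
qed

text \<open>Ext vanishing in degrees -1, 0 and 1 is later expressed by this one predicate with
  \<open>Sh\<close> on at most one argument, so the inverse shift stays out of the Hom
  arguments.\<close>

definition orth :: "'a \<Rightarrow> 'a \<Rightarrow> bool" where
  "orth X Y \<longleftrightarrow> (\<forall>f \<in> Hom D X Y. f = Zero D X Y)"

lemma orthD: "\<lbrakk>orth X Y; f \<in> Hom D X Y\<rbrakk> \<Longrightarrow> f = Zero D X Y"
  by (simp add: orth_def)

lemma orth_zero_object:
  assumes "zero_object D Z" "X \<in> Obj D"
  shows "orth Z X" and "orth X Z"
  using assms Zero_in_Hom unfolding orth_def zero_object_def by blast+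

text \<open>Both sides amount to the identity of \<open>Z\<close> being zero. Objects can thus be
  shown to vanish by Hom computations alone.\<close>

lemma zero_object_iff_orth: "zero_object D Z \<longleftrightarrow> Z \<in> Obj D \<and> orth Z Z"
proof
  assume Z: "zero_object D Z"
  then have o: "Z \<in> Obj D" by (simp add: zero_object_def)
  then show "Z \<in> Obj D \<and> orth Z Z" using orth_zero_object(1)[OF Z o] by blast
next
  assume Z: "Z \<in> Obj D \<and> orth Z Z"
  then show "zero_object D Z" using zero_objectI[of Z] orthD[of Z Z] Id_in_Hom[of Z] by blast
qed

lemma orth_retract:
  assumes o: "A \<in> Obj D" "B \<in> Obj D" "Y \<in> Obj D"
    and fs: "s \<in> Hom D B A" "f \<in> Hom D A B" "f \<bullet> s = Ide D B"
    and AY: "orth A Y"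
  shows "orth B Y"
  unfolding orth_def
proof
  fix y assume y: "y \<in> Hom D B Y"
  have "y = (y \<bullet> f) \<bullet> s"
    using Comp_assoc[OF o(2,1,2,3) fs(1,2) y] fs(3) Comp_Id[OF o(2,3) y] by simp
  also have "y \<bullet> f = Zero D A Y"
    using orthD[OF AY Comp_in_Hom[OF o fs(2) y]] .
  finally show "y = Zero D B Y" using Zero_Comp[OF o(2,1,3) fs(1)] by simp
qed

lemma orth_iso_left:
  assumes o: "A \<in> Obj D" "B \<in> Obj D" "Y \<in> Obj D" and "isomorphic D A B" "orth A Y"
  shows "orth B Y"
  using assms orth_retract[OF o] unfolding isomorphic_def isomorphism_def by blast

lemma orth_iso_right:
  assumes o: "A \<in> Obj D" "B \<in> Obj D" "X \<in> Obj D" and AB: "isomorphic D A B" and XA: "orth X A"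
  shows "orth X B"
  unfolding orth_def
proof
  fix x assume x: "x \<in> Hom D X B"
  obtain f s where fs: "f \<in> Hom D A B" "s \<in> Hom D B A" "f \<bullet> s = Ide D B"
    using AB unfolding isomorphic_def isomorphism_def by blast
  have "x = f \<bullet> (s \<bullet> x)"
    using Comp_assoc[OF o(3,2,1,2) x fs(2,1)] fs(3) Id_Comp[OF o(3,2) x] by simp
  also have "s \<bullet> x = Zero D X A"
    using orthD[OF XA Comp_in_Hom[OF o(3,2,1) x fs(2)]] .
  finally show "x = Zero D X B" using Comp_Zero[OF o(3,1,2) fs(1)] by simp
qed

lemma isomorphic_sym: "isomorphic D A B \<Longrightarrow> isomorphic D B A"
  unfolding isomorphic_def isomorphism_def by blast

end

section \<open>Exactness of Hom along distinguished triangles, in both variables\<close>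

context triangulated_category
begin

lemma Sh_Obj: "A \<in> Obj D \<Longrightarrow> Sh D A \<in> Obj D"
  using bij_Sh bij_betwE by blast

lemma Shm_Hom: "\<lbrakk>A \<in> Obj D; B \<in> Obj D; f \<in> Hom D A B\<rbrakk> \<Longrightarrow> Shm D f \<in> Hom D (Sh D A) (Sh D B)"
  using bij_Shm bij_betwE by blast

lemma Shm_inject:
  "\<lbrakk>A \<in> Obj D; B \<in> Obj D; f \<in> Hom D A B; g \<in> Hom D A B; Shm D f = Shm D g\<rbrakk> \<Longrightarrow> f = g"
  using bij_Shm[of A B] by (auto simp: bij_betw_def inj_on_def)

lemma Shm_surj:
  "\<lbrakk>A \<in> Obj D; B \<in> Obj D; g \<in> Hom D (Sh D A) (Sh D B)\<rbrakk> \<Longrightarrow> \<exists>f \<in> Hom D A B. g = Shm D f"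
  using bij_Shm[of A B] by (auto simp: bij_betw_def)

lemma Shm_Zero:
  assumes "A \<in> Obj D" "B \<in> Obj D"
  shows "Shm D (Zero D A B) = Zero D (Sh D A) (Sh D B)"
proof -
  note z = Zero_in_Hom[OF assms]
  have "Add D (Shm D (Zero D A B)) (Shm D (Zero D A B)) = Shm D (Zero D A B)"
    using Shm_Add[OF assms z z] Add_Zero[OF assms z] by simp
  then show ?thesis
    using Zero_unique[OF Sh_Obj Sh_Obj] assms Shm_Hom[OF assms z] by blast
qed

lemma orth_Sh_iff:
  assumes "A \<in> Obj D" "B \<in> Obj D"
  shows "orth (Sh D A) (Sh D B) \<longleftrightarrow> orth A B"
  unfolding orth_def
  using Shm_surj[OF assms] Shm_inject[OF assms] Shm_Hom[OF assms] Shm_Zero[OF assms]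
    Zero_in_Hom[OF assms] by metis

lemma zero_object_Sh: "zero_object D Z \<Longrightarrow> zero_object D (Sh D Z)"
  using orth_Sh_iff Sh_Obj unfolding zero_object_iff_orth by blast

lemma Tri_rotateI:
  "Tri D A B C f g h \<Longrightarrow> Tri D B C (Sh D A) g h (Neg D (Sh D A) (Sh D B) (Shm D f))"
  using Tri_rotate Tri_typed by metis

lemma Tri_Sh:
  "Tri D A B C f g h \<Longrightarrow> \<exists>f' g' h'. Tri D (Sh D A) (Sh D B) (Sh D C) f' g' h'"
  using Tri_rotateI by blast

text \<open>This is the identity triangle on \<open>A\<close> with zero object
  \<open>Sh D Z\<close>, rotated backwards. The sign produced by the rotation falls on a zero
  map.\<close>

lemma Tri_Zero_Id:
  assumes A: "A \<in> Obj D" and Z: "zero_object D Z"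
  shows "Tri D Z A A (Zero D Z A) (Ide D A) (Zero D A (Sh D Z))"
proof -
  have o: "Z \<in> Obj D" using Z by (simp add: zero_object_def)
  note so = Sh_Obj[OF o] Sh_Obj[OF A]
  have "Tri D A A (Sh D Z) (Ide D A) (Zero D A (Sh D Z)) (Zero D (Sh D Z) (Sh D A))"
    by (rule Tri_Id[OF A zero_object_Sh[OF Z]])
  then show ?thesis
    using Tri_rotate[OF o A A] Zero_in_Hom Id_in_Hom A o so Shm_Zero Neg_Zero by metis
qed

text \<open>\<open>g\<close> is a weak cokernel of \<open>f\<close>: since
  \<open>y \<bullet> f\<close> vanishes, the pair (zero map \<open>A\<close> to \<open>Z\<close>,
  \<open>y\<close>) is a commuting square into the triangle \<open>Z\<close>, \<open>Y\<close>,
  \<open>Y\<close>, and the completing third map is the factorization.\<close>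

lemma Tri_factor:
  assumes T: "Tri D A B C f g h" and Y: "Y \<in> Obj D" "y \<in> Hom D B Y" "y \<bullet> f = Zero D A Y"
  shows "\<exists>c \<in> Hom D C Y. y = c \<bullet> g"
proof -
  obtain Z where Z: "zero_object D Z" using ex_zero_object by blast
  then have o: "Z \<in> Obj D" by (simp add: zero_object_def)
  note t = Tri_typed[OF T]
  have "y \<bullet> f = Zero D Z Y \<bullet> Zero D A Z"
    using t Y o Comp_Zero Zero_in_Hom by metis
  then obtain c where "c \<in> Hom D C Y" "c \<bullet> g = Ide D Y \<bullet> y"
    using Tri_complete[OF T Tri_Zero_Id[OF Y(1) Z] Zero_in_Hom] t o Y by blast
  then show ?thesis using Id_Comp t Y by metis
qed

lemma Tri_factor_connecting:
  assumes T: "Tri D A B C f g h" and Y: "Y \<in> Obj D" "y \<in> Hom D C Y" "y \<bullet> g = Zero D B Y"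
  shows "\<exists>c \<in> Hom D (Sh D A) Y. y = c \<bullet> h"
  using Tri_factor[OF Tri_rotateI[OF T]] Y by blast

text \<open>\<open>f\<close> is a weak kernel of \<open>g\<close>. The completion axiom only
  produces third components, so both the identity triangle on \<open>X\<close> and the given
  triangle are rotated once. The lift then appears shifted and with a sign on both sides, which
  injectivity of \<open>Neg\<close> and full faithfulness of the shift remove.\<close>

lemma Tri_lift:
  assumes T: "Tri D A B C f g h" and X: "X \<in> Obj D" "x \<in> Hom D X B" "g \<bullet> x = Zero D X C"
  shows "\<exists>c \<in> Hom D X A. x = f \<bullet> c"
proof -
  obtain Z where Z: "zero_object D Z" using ex_zero_object by blast
  then have o: "Z \<in> Obj D" by (simp add: zero_object_def)
  note t = Tri_typed[OF T]
  have tt: "A \<in> Obj D" "B \<in> Obj D" "C \<in> Obj D" "f \<in> Hom D A B" using t by auto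
  note so = Sh_Obj[OF X(1)] Sh_Obj[OF tt(1)] Sh_Obj[OF tt(2)]
  note Sx = Shm_Hom[OF X(1) tt(2) X(2)]
  note Sf = Shm_Hom[OF tt(1,2,4)]
  have "Zero D Z C \<bullet> Zero D X Z = g \<bullet> x"
    using t X o Comp_Zero Zero_in_Hom by metis
  then obtain c where c: "c \<in> Hom D (Sh D X) (Sh D A)"
    "Shm D x \<bullet> Neg D (Sh D X) (Sh D X) (Shm D (Ide D X)) = Neg D (Sh D A) (Sh D B) (Shm D f) \<bullet> c"
    using Tri_complete[OF Tri_rotateI[OF Tri_Id[OF X(1) Z]] Tri_rotateI[OF T] X(2) Zero_in_Hom] t o X
    by blast
  have "Neg D (Sh D X) (Sh D B) (Shm D x) = Neg D (Sh D X) (Sh D B) (Shm D f \<bullet> c)"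
    using c(2) Comp_Neg[OF so(1,1,3) Id_in_Hom[OF so(1)] Sx] Comp_Id[OF so(1,3) Sx]
      Neg_Comp[OF so(1,2,3) c(1) Sf] by (simp add: Shm_Id[OF X(1)])
  then have eq: "Shm D x = Shm D f \<bullet> c"
    using Neg_inject[OF so(1,3) Sx Comp_in_Hom[OF so c(1) Sf]] by blast
  obtain c' where c': "c' \<in> Hom D X A" "c = Shm D c'"
    using Shm_surj[OF X(1) tt(1) c(1)] by blast
  have "x = f \<bullet> c'"
    using Shm_inject[OF X(1) tt(2) X(2) Comp_in_Hom[OF X(1) tt(1,2) c'(1) tt(4)]] eq c'(2)
      Shm_Comp[OF X(1) tt(1,2) c'(1) tt(4)] by simp
  then show ?thesis using c' by blast
qed

lemma Tri_lift_connecting: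
  assumes T: "Tri D A B C f g h" and X: "X \<in> Obj D" "x \<in> Hom D X C" "h \<bullet> x = Zero D X (Sh D A)"
  shows "\<exists>c \<in> Hom D X B. x = g \<bullet> c"
  using Tri_lift[OF Tri_rotateI[OF T]] X by blast

text \<open>\<open>Ide D A\<close> and \<open>f\<close> map the identity triangle on
  \<open>A\<close> to the given one; the third component makes \<open>g \<bullet> f\<close> factor
  through a zero object.\<close>

lemma Tri_Comp_Zero:
  assumes T: "Tri D A B C f g h"
  shows "g \<bullet> f = Zero D A C"
proof -
  obtain Z where Z: "zero_object D Z" using ex_zero_object by blast
  then have o: "Z \<in> Obj D" by (simp add: zero_object_def)
  have t: "A \<in> Obj D" "B \<in> Obj D" "C \<in> Obj D" "f \<in> Hom D A B" "g \<in> Hom D B C"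
    using Tri_typed[OF T] by auto
  obtain c where c: "c \<in> Hom D Z C" "c \<bullet> Zero D A Z = g \<bullet> f"
    using Tri_complete[OF Tri_Id[OF t(1) Z] T Id_in_Hom[OF t(1)] t(4)] by blast
  then show ?thesis using Comp_Zero[OF t(1) o t(3) c(1)] by simp
qed

lemma Tri_orth_middle_right:
  assumes T: "Tri D A B C f g h" and X: "X \<in> Obj D" "orth X A" "orth X C"
  shows "orth X B"
  unfolding orth_def
proof
  fix x assume x: "x \<in> Hom D X B"
  have t: "A \<in> Obj D" "B \<in> Obj D" "C \<in> Obj D" "f \<in> Hom D A B" "g \<in> Hom D B C"
    using Tri_typed[OF T] by auto
  obtain c where "c \<in> Hom D X A" "x = f \<bullet> c"
    using Tri_lift[OF T X(1) x orthD[OF X(3) Comp_in_Hom[OF X(1) t(2,3) x t(5)]]] by blast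
  then show "x = Zero D X B"
    using orthD[OF X(2)] Comp_Zero[OF X(1) t(1,2,4)] by simp
qed

lemma Tri_orth_middle_left:
  assumes T: "Tri D A B C f g h" and Y: "Y \<in> Obj D" "orth A Y" "orth C Y"
  shows "orth B Y"
  unfolding orth_def
proof
  fix y assume y: "y \<in> Hom D B Y"
  have t: "A \<in> Obj D" "B \<in> Obj D" "C \<in> Obj D" "f \<in> Hom D A B" "g \<in> Hom D B C"
    using Tri_typed[OF T] by auto
  obtain c where "c \<in> Hom D C Y" "y = c \<bullet> g"
    using Tri_factor[OF T Y(1) y orthD[OF Y(2) Comp_in_Hom[OF t(1,2) Y(1) t(4) y]]] by blast
  then show "y = Zero D B Y"
    using orthD[OF Y(3)] Zero_Comp[OF t(2,3) Y(1) t(5)] by simp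
qed

lemma Tri_orth_third_left:
  assumes T: "Tri D A B C f g h" and "Y \<in> Obj D" "orth B Y" "orth (Sh D A) Y"
  shows "orth C Y"
  using Tri_orth_middle_left[OF Tri_rotateI[OF T]] assms by blast

text \<open>The difference \<open>d\<close> of \<open>x\<close> and \<open>y\<close> is killed by
  \<open>f\<close>, so in the triangle rotated twice its shift lifts along \<open>h\<close> to a map
  from \<open>Sh D X\<close> to \<open>C\<close>, which is zero.\<close>

lemma Tri_mono:
  assumes T: "Tri D A B C f g h" and X: "X \<in> Obj D" "orth (Sh D X) C"
    and xy: "x \<in> Hom D X A" "y \<in> Hom D X A" "f \<bullet> x = f \<bullet> y"
  shows "x = y"
proof -
  have t: "A \<in> Obj D" "B \<in> Obj D" "C \<in> Obj D" "f \<in> Hom D A B" "g \<in> Hom D B C"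
    "h \<in> Hom D C (Sh D A)"
    using Tri_typed[OF T] by auto
  note so = Sh_Obj[OF X(1)] Sh_Obj[OF t(1)] Sh_Obj[OF t(2)]
  note Sf = Shm_Hom[OF t(1,2,4)]
  obtain d where d: "d \<in> Hom D X A" "x = Add D d y"
    using ex_difference[OF X(1) t(1) xy(1,2)] by blast
  note Sd = Shm_Hom[OF X(1) t(1) d(1)]
  have "Add D (f \<bullet> d) (f \<bullet> y) = f \<bullet> y"
    using Comp_Add[OF X(1) t(1,2) d(1) xy(2) t(4)] xy(3) d(2) by simp
  then have "f \<bullet> d = Zero D X B"
    using Zero_unique[OF X(1) t(2)] Comp_in_Hom[OF X(1) t(1,2) _ t(4)] d(1) xy(2) by blast
  then have "Shm D f \<bullet> Shm D d = Zero D (Sh D X) (Sh D B)"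
    using Shm_Comp[OF X(1) t(1,2) d(1) t(4)] Shm_Zero[OF X(1) t(2)] by simp
  then have "Neg D (Sh D A) (Sh D B) (Shm D f) \<bullet> Shm D d = Zero D (Sh D X) (Sh D B)"
    using Neg_Comp[OF so Sd Sf] Neg_Zero[OF so(1,3)] by simp
  then obtain c where "c \<in> Hom D (Sh D X) C" "Shm D d = h \<bullet> c"
    using Tri_lift[OF Tri_rotateI[OF Tri_rotateI[OF T]] so(1) Sd] by blast
  then have "Shm D d = Shm D (Zero D X A)"
    using orthD[OF X(2)] Comp_Zero[OF so(1) t(3) so(2) t(6)] Shm_Zero[OF X(1) t(1)] by simp
  then have "d = Zero D X A"
    using Shm_inject[OF X(1) t(1) d(1) Zero_in_Hom[OF X(1) t(1)]] by blast
  then show ?thesis using d(2) Add_Zero[OF X(1) t(1) xy(2)] by simp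
qed

lemma Tri_orth_first_right:
  assumes T: "Tri D A B C f g h" and X: "X \<in> Obj D" "orth X B" "orth (Sh D X) C"
  shows "orth X A"
  unfolding orth_def
proof
  fix x assume x: "x \<in> Hom D X A"
  have t: "A \<in> Obj D" "B \<in> Obj D" "f \<in> Hom D A B" using Tri_typed[OF T] by auto
  note z = Zero_in_Hom[OF X(1) t(1)]
  show "x = Zero D X A"
    using Tri_mono[OF T X(1,3) x z] orthD[OF X(2)] Comp_in_Hom[OF X(1) t(1,2) _ t(3)] x z by metis
qed

text \<open>The composite with \<open>h\<close> is the obstruction to extending \<open>y\<close>
  along \<open>f\<close> to \<open>B\<close>. When it vanishes, \<open>y\<close> factors through
  \<open>B\<close>, from which only the zero map reaches \<open>Y\<close>; the argument is carried
  out after one shift.\<close>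

lemma Tri_extend_zero:
  assumes T: "Tri D A B C f g h" and Y: "Y \<in> Obj D" "orth B Y"
    and y: "y \<in> Hom D A Y" "Shm D y \<bullet> h = Zero D C (Sh D Y)"
  shows "y = Zero D A Y"
proof -
  have t: "A \<in> Obj D" "B \<in> Obj D" "f \<in> Hom D A B" using Tri_typed[OF T] by auto
  note so = Sh_Obj[OF t(1)] Sh_Obj[OF t(2)] Sh_Obj[OF Y(1)]
  note Sy = Shm_Hom[OF t(1) Y(1) y(1)]
  obtain c where "c \<in> Hom D (Sh D B) (Sh D Y)"
    "Shm D y = c \<bullet> Neg D (Sh D A) (Sh D B) (Shm D f)"
    using Tri_factor[OF Tri_rotateI[OF Tri_rotateI[OF T]] so(3) Sy y(2)] by blast
  then have "Shm D y = Shm D (Zero D A Y)"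
    using orth_Sh_iff[OF t(2) Y(1)] Y(2) orthD Zero_Comp[OF so] Neg_in_Hom[OF so(1,2)]
      Shm_Hom[OF t] Shm_Zero[OF t(1) Y(1)] by metis
  then show ?thesis
    using Shm_inject[OF t(1) Y(1) y(1) Zero_in_Hom[OF t(1) Y(1)]] by blast
qed

text \<open>The identity of \<open>B\<close> lifts along \<open>f\<close>, giving a right inverse
  \<open>s\<close>. It is also a left inverse because \<open>Tri_mono\<close> cancels
  \<open>f\<close>: only zero maps reach \<open>C\<close>.\<close>

lemma Tri_third_zero_iso:
  assumes T: "Tri D A B C f g h" and C: "zero_object D C"
  shows "isomorphic D A B"
proof -
  have t: "A \<in> Obj D" "B \<in> Obj D" "C \<in> Obj D" "f \<in> Hom D A B" "g \<in> Hom D B C"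
    using Tri_typed[OF T] by auto
  have "g \<bullet> Ide D B = Zero D B C"
    using orthD[OF orth_zero_object(2)[OF C t(2)]] Comp_in_Hom[OF t(2,2,3) Id_in_Hom[OF t(2)] t(5)]
    by blast
  then obtain s where s: "s \<in> Hom D B A" "Ide D B = f \<bullet> s"
    using Tri_lift[OF T t(2) Id_in_Hom[OF t(2)]] by blast
  have sf: "s \<bullet> f \<in> Hom D A A" using Comp_in_Hom[OF t(1,2,1,4) s(1)] .
  have "f \<bullet> (s \<bullet> f) = f"
    using trans[OF Comp_assoc[OF t(1,2,1,2,4) s(1) t(4)] arg_cong[where f = "\<lambda>x. x \<bullet> f", OF s(2)[symmetric]]]
      Id_Comp[OF t(1,2,4)] by (rule trans)
  also have "\<dots> = f \<bullet> Ide D A" by (rule Comp_Id[OF t(1,2,4), symmetric])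
  finally have "f \<bullet> (s \<bullet> f) = f \<bullet> Ide D A" .
  then have "s \<bullet> f = Ide D A"
    using Tri_mono[OF T t(1) _ sf Id_in_Hom[OF t(1)]] orth_zero_object(2)[OF C Sh_Obj[OF t(1)]]
    by blast
  then have "isomorphism D A B f"
    unfolding isomorphism_def using t(4) s(1) s(2)[symmetric] by blast
  then show ?thesis unfolding isomorphic_def by blast
qed

lemma Tri_first_zero_iso:
  "\<lbrakk>Tri D A B C f g h; zero_object D A\<rbrakk> \<Longrightarrow> isomorphic D B C"
  using Tri_third_zero_iso[OF Tri_rotateI] zero_object_Sh by blast

text \<open>Endomorphisms of \<open>C\<close> are squeezed between maps from \<open>B\<close> and
  maps from \<open>Sh D A\<close>. In a torsion decomposition of \<open>B\<close> this kills the
  torsion-free part; \<open>Tri_first_zero\<close> is the dual for the torsion part.\<close>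

lemma Tri_second_zero_imp_third_zero:
  assumes T: "Tri D A B C f g h" and AC: "orth (Sh D A) C" and BC: "orth B C"
  shows "zero_object D C"
  using Tri_orth_third_left[OF T _ BC AC] Tri_typed[OF T] zero_object_iff_orth by blast

lemma Tri_first_zero:
  assumes T: "Tri D A B C f g h" and AC: "orth (Sh D A) C" and AB: "orth A B"
  shows "zero_object D A"
  using Tri_orth_first_right[OF T _ AB AC] Tri_typed[OF T] zero_object_iff_orth by blast

end

section \<open>Coproducts in a full subcategory, tested on its own objects\<close>

context category
begin

lemma coproduct_eq:
  assumes "is_coproduct D \<X> \<alpha> W P \<iota>" "\<X> \<subseteq> Obj D" "Y \<in> \<X>" "u \<in> Hom D P Y" "v \<in> Hom D P Y"
    and eq: "\<And>i. i \<in> \<alpha> \<Longrightarrow> u \<bullet> \<iota> i = v \<bullet> \<iota> i"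
  shows "u = v"
proof -
  have P: "P \<in> \<X>" "\<And>i. i \<in> \<alpha> \<Longrightarrow> W i \<in> \<X>" "\<And>i. i \<in> \<alpha> \<Longrightarrow> \<iota> i \<in> Hom D (W i) P"
    using assms(1) by (auto simp: is_coproduct_def)
  have o: "P \<in> Obj D" "Y \<in> Obj D" "\<And>i. i \<in> \<alpha> \<Longrightarrow> W i \<in> Obj D"
    using P assms(2,3) by blast+
  have "\<forall>i\<in>\<alpha>. v \<bullet> \<iota> i \<in> Hom D (W i) Y"
    using Comp_in_Hom[OF o(3,1,2) P(3) assms(5)] by blast
  then have "\<exists>!w. w \<in> Hom D P Y \<and> (\<forall>i\<in>\<alpha>. w \<bullet> \<iota> i = v \<bullet> \<iota> i)"
    using assms(1,3) by (simp add: is_coproduct_def)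
  then show ?thesis using assms(4,5) eq by blast
qed

end

lemma (in additive_category) coproduct_orth:
  assumes cop: "is_coproduct D \<X> \<alpha> W P \<iota>" and X: "\<X> \<subseteq> Obj D" "Y \<in> \<X>"
    and W: "\<And>i. i \<in> \<alpha> \<Longrightarrow> orth (W i) Y"
  shows "orth P Y"
  unfolding orth_def
proof
  fix u assume u: "u \<in> Hom D P Y"
  have P: "P \<in> \<X>" "\<And>i. i \<in> \<alpha> \<Longrightarrow> W i \<in> \<X>" "\<And>i. i \<in> \<alpha> \<Longrightarrow> \<iota> i \<in> Hom D (W i) P"
    using cop by (auto simp: is_coproduct_def)
  have o: "P \<in> Obj D" "Y \<in> Obj D" "\<And>i. i \<in> \<alpha> \<Longrightarrow> W i \<in> Obj D"
    using P X by blast+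
  show "u = Zero D P Y"
  proof (rule coproduct_eq[OF cop X u Zero_in_Hom[OF o(1,2)]])
    fix i assume i: "i \<in> \<alpha>"
    show "u \<bullet> \<iota> i = Zero D P Y \<bullet> \<iota> i"
      using orthD[OF W[OF i] Comp_in_Hom[OF o(3)[OF i] o(1,2) P(3)[OF i] u]]
        Zero_Comp[OF o(3)[OF i] o(1,2) P(3)[OF i]] by simp
  qed
qed

section \<open>Ext vanishing and s-torsion pairs in terms of orthogonality\<close>

context triangulated_category
begin

lemma unshift:
  assumes "Y \<in> Obj D"
  shows "shift_pow D (- 1) Y \<in> Obj D" "Sh D (shift_pow D (- 1) Y) = Y"
proof -
  have "Y \<in> Sh D ` Obj D" using assms bij_Sh by (simp add: bij_betw_def)
  then show "shift_pow D (- 1) Y \<in> Obj D" "Sh D (shift_pow D (- 1) Y) = Y"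
    by (simp_all add: shift_pow_def inv_into_into f_inv_into_f)
qed

lemma mem_unshift_image_iff:
  assumes "S \<subseteq> Obj D"
  shows "X \<in> shift_pow D (- 1) ` S \<longleftrightarrow> X \<in> Obj D \<and> Sh D X \<in> S"
proof
  assume "X \<in> shift_pow D (- 1) ` S"
  then show "X \<in> Obj D \<and> Sh D X \<in> S" using unshift assms by auto
next
  assume X: "X \<in> Obj D \<and> Sh D X \<in> S"
  then have "X = shift_pow D (- 1) (Sh D X)"
    using bij_Sh by (simp add: shift_pow_def bij_betw_def)
  then show "X \<in> shift_pow D (- 1) ` S" using X by blast
qed

text \<open>In degree -1 both arguments are shifted once, which cancels the inverse shift on
  \<open>Y\<close> and moves the shift to \<open>X\<close>.\<close>

lemma Ext_zero_iff_orth: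
  assumes "X \<in> Obj D" "Y \<in> Obj D"
  shows "Ext_zero D 0 X Y \<longleftrightarrow> orth X Y"
    and "Ext_zero D 1 X Y \<longleftrightarrow> orth X (Sh D Y)"
    and "Ext_zero D (- 1) X Y \<longleftrightarrow> orth (Sh D X) Y"
proof -
  have Hom: "Hom D X B = {Zero D X B} \<longleftrightarrow> orth X B" if "B \<in> Obj D" for B
    using Zero_in_Hom[OF assms(1) that] by (auto simp: orth_def)
  show "Ext_zero D 0 X Y \<longleftrightarrow> orth X Y" "Ext_zero D 1 X Y \<longleftrightarrow> orth X (Sh D Y)"
    using Hom assms Sh_Obj by (simp_all add: Ext_zero_def shift_pow_def)
  show "Ext_zero D (- 1) X Y \<longleftrightarrow> orth (Sh D X) Y"
    using Hom[OF unshift(1)[OF assms(2)]] orth_Sh_iff[OF assms(1) unshift(1)[OF assms(2)]]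
      unshift(2)[OF assms(2)]
    by (simp add: Ext_zero_def)
qed

lemma perp_iff:
  assumes "V \<in> Obj D" "\<X> \<subseteq> Obj D"
  shows "X \<in> perp D \<X> 0 V \<longleftrightarrow> X \<in> \<X> \<and> orth V X"
    and "X \<in> perp D \<X> 1 V \<longleftrightarrow> X \<in> \<X> \<and> orth V (Sh D X)"
  using assms Ext_zero_iff_orth unfolding perp_def by blast+

lemma perp_iso_closed:
  assumes "V \<in> Obj D" "\<X> \<subseteq> Obj D"
  shows "iso_closed_in D \<X> (perp D \<X> 0 V)"
  unfolding iso_closed_in_def
proof (intro conjI ballI impI)
  show "perp D \<X> 0 V \<subseteq> \<X>" by (auto simp: perp_def)
next
  fix A B assume A: "A \<in> perp D \<X> 0 V" and B: "B \<in> \<X>" and AB: "isomorphic D A B"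
  have "A \<in> \<X>" "orth V A" using A by (simp_all add: perp_iff[OF assms])
  then have "orth V B" using orth_iso_right[OF _ _ assms(1) AB] B assms(2) by blast
  then show "B \<in> perp D \<X> 0 V" using B by (simp add: perp_iff[OF assms])
qed

lemma storsD:
  assumes t: "(\<T>, \<F>) \<in> stors D \<X>" and X: "\<X> \<subseteq> Obj D"
  shows "iso_closed_in D \<X> \<T>" and "iso_closed_in D \<X> \<F>" and "\<T> \<subseteq> \<X>" and "\<F> \<subseteq> \<X>"
    and "\<And>A B. \<lbrakk>A \<in> \<T>; B \<in> \<F>\<rbrakk> \<Longrightarrow> orth A B"
    and "\<And>A B. \<lbrakk>A \<in> \<T>; B \<in> \<F>\<rbrakk> \<Longrightarrow> orth (Sh D A) B"
    and "\<And>C. C \<in> \<X> \<Longrightarrow> \<exists>A \<in> \<T>. \<exists>B \<in> \<F>. \<exists>f g h. Tri D A C B f g h"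
proof -
  show iso: "iso_closed_in D \<X> \<T>" "iso_closed_in D \<X> \<F>"
    using t by (simp_all add: stors_def)
  then show sub: "\<T> \<subseteq> \<X>" "\<F> \<subseteq> \<X>" by (simp_all add: iso_closed_in_def)
  fix A B assume "A \<in> \<T>" "B \<in> \<F>"
  moreover from this have o: "A \<in> Obj D" "B \<in> Obj D" using sub X by blast+
  ultimately have "Ext_zero D 0 A B \<and> Ext_zero D (- 1) A B"
    using t by (auto simp: stors_def)
  then show "orth A B" "orth (Sh D A) B"
    by (simp_all add: Ext_zero_iff_orth[OF o])
next
  fix C assume "C \<in> \<X>"
  moreover have "\<X> = star D \<X> \<T> \<F>" using t by (simp add: stors_def)
  ultimately have "C \<in> star D \<X> \<T> \<F>" by simp
  then show "\<exists>A \<in> \<T>. \<exists>B \<in> \<F>. \<exists>f g h. Tri D A C B f g h"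
    unfolding star_def conflation_def by blast
qed

lemma storsI:
  assumes X: "\<X> \<subseteq> Obj D" and iso: "iso_closed_in D \<X> \<T>" "iso_closed_in D \<X> \<F>"
    and orth: "\<And>A B. \<lbrakk>A \<in> \<T>; B \<in> \<F>\<rbrakk> \<Longrightarrow> orth A B"
      "\<And>A B. \<lbrakk>A \<in> \<T>; B \<in> \<F>\<rbrakk> \<Longrightarrow> orth (Sh D A) B"
    and dec: "\<And>C. C \<in> \<X> \<Longrightarrow> \<exists>A \<in> \<T>. \<exists>B \<in> \<F>. \<exists>f g h. Tri D A C B f g h"
  shows "(\<T>, \<F>) \<in> stors D \<X>"
proof -
  have sub: "\<T> \<subseteq> \<X>" "\<F> \<subseteq> \<X>" using iso by (simp_all add: iso_closed_in_def)
  have "Ext_zero D 0 A B \<and> Ext_zero D (- 1) A B" if AB: "A \<in> \<T>" "B \<in> \<F>" for A B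
  proof -
    have "A \<in> Obj D" "B \<in> Obj D" using AB sub X by blast+
    then show ?thesis using orth AB Ext_zero_iff_orth(1,3) by simp
  qed
  moreover have "\<X> \<subseteq> star D \<X> \<T> \<F>"
  proof
    fix C assume C: "C \<in> \<X>"
    then obtain A B f g h where "A \<in> \<T>" "B \<in> \<F>" "Tri D A C B f g h" using dec by blast
    then show "C \<in> star D \<X> \<T> \<F>"
      using C sub unfolding star_def conflation_def by blast
  qed
  moreover have "star D \<X> \<T> \<F> \<subseteq> \<X>" by (auto simp: star_def conflation_def)
  ultimately show ?thesis using iso unfolding stors_def by blast
qed

text \<open>In the decomposition of \<open>C\<close> the torsion-free part receives only zero maps
  from \<open>C\<close> and from the shifted torsion part, so it vanishes and \<open>C\<close> is
  isomorphic to its torsion part.\<close>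

lemma stors_mem_fst_iff:
  assumes t: "(\<T>, \<F>) \<in> stors D \<X>" and X: "\<X> \<subseteq> Obj D" and C: "C \<in> \<X>"
  shows "C \<in> \<T> \<longleftrightarrow> (\<forall>B \<in> \<F>. orth C B)"
proof
  assume o: "\<forall>B \<in> \<F>. orth C B"
  obtain A B f g h where AB: "A \<in> \<T>" "B \<in> \<F>" and T: "Tri D A C B f g h"
    using storsD(7)[OF t X C] by blast
  have "zero_object D B"
    using Tri_second_zero_imp_third_zero[OF T storsD(6)[OF t X AB]] o AB(2) by blast
  then have "isomorphic D A C" by (rule Tri_third_zero_iso[OF T])
  then show "C \<in> \<T>"
    using storsD(1)[OF t X] C AB(1) unfolding iso_closed_in_def by blast
qed (use storsD(5)[OF t X] in blast)

lemma stors_mem_snd_iff: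
  assumes t: "(\<T>, \<F>) \<in> stors D \<X>" and X: "\<X> \<subseteq> Obj D" and C: "C \<in> \<X>"
  shows "C \<in> \<F> \<longleftrightarrow> (\<forall>A \<in> \<T>. orth A C)"
proof
  assume o: "\<forall>A \<in> \<T>. orth A C"
  obtain A B f g h where AB: "A \<in> \<T>" "B \<in> \<F>" and T: "Tri D A C B f g h"
    using storsD(7)[OF t X C] by blast
  have "zero_object D A"
    using Tri_first_zero[OF T storsD(6)[OF t X AB]] o AB(1) by blast
  then have "isomorphic D B C" by (rule isomorphic_sym[OF Tri_first_zero_iso[OF T]])
  then show "C \<in> \<F>"
    using storsD(2)[OF t X] C AB(2) unfolding iso_closed_in_def by blast
qed (use storsD(5)[OF t X] in blast)

end

section \<open>The two hearts and the torsion pair inside the larger one\<close>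

locale torsion_interval = triangulated_category D
  for D :: "('o, 'm, 'z) triangulated_category_scheme" (structure)
    and \<T>\<^sub>1 \<F>\<^sub>1 \<T>\<^sub>2 \<F>\<^sub>2 :: "'o set" +
  assumes t1: "(\<T>\<^sub>1, \<F>\<^sub>1) \<in> stors D (Obj D)"
    and t2: "(\<T>\<^sub>2, \<F>\<^sub>2) \<in> stors D (Obj D)"
    and t1_le_t2: "tors_le (\<T>\<^sub>1, \<F>\<^sub>1) (\<T>\<^sub>2, \<F>\<^sub>2)"
    and t2_le_unshift_t1: "tors_le (\<T>\<^sub>2, \<F>\<^sub>2) (tors_shift D (- 1) (\<T>\<^sub>1, \<F>\<^sub>1))"
begin

text \<open>
  \<open>\<A>\<close> is the heart of the t-structure belonging to the first torsion pair; inside it,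
  \<open>(\<H>, \<K>)\<close> is an ordinary torsion pair.
\<close>

definition "\<A> = heart (\<T>\<^sub>1, \<F>\<^sub>1) (tors_shift D (- 1) (\<T>\<^sub>1, \<F>\<^sub>1))"
definition "\<H> = heart (\<T>\<^sub>1, \<F>\<^sub>1) (\<T>\<^sub>2, \<F>\<^sub>2)"
definition "\<K> = heart (\<T>\<^sub>2, \<F>\<^sub>2) (tors_shift D (- 1) (\<T>\<^sub>1, \<F>\<^sub>1))"

lemma torsion_Obj: "\<T>\<^sub>1 \<subseteq> Obj D" "\<F>\<^sub>1 \<subseteq> Obj D" "\<T>\<^sub>2 \<subseteq> Obj D" "\<F>\<^sub>2 \<subseteq> Obj D"
  using storsD(3,4)[OF t1] storsD(3,4)[OF t2] by auto

lemmas T1_iff = stors_mem_fst_iff[OF t1 subset_refl]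
lemmas F1_iff = stors_mem_snd_iff[OF t1 subset_refl]
lemmas T2_iff = stors_mem_fst_iff[OF t2 subset_refl]
lemmas F2_iff = stors_mem_snd_iff[OF t2 subset_refl]

lemma T1_subset_T2: "\<T>\<^sub>1 \<subseteq> \<T>\<^sub>2"
  using t1_le_t2 by (simp add: tors_le_def)

lemma Sh_T2: "X \<in> \<T>\<^sub>2 \<Longrightarrow> Sh D X \<in> \<T>\<^sub>1"
  using t2_le_unshift_t1 mem_unshift_image_iff[OF torsion_Obj(1)]
  by (auto simp: tors_le_def tors_shift_def)

lemma F2_subset_F1: "\<F>\<^sub>2 \<subseteq> \<F>\<^sub>1"
  using F1_iff F2_iff T1_subset_T2 torsion_Obj(4) by blast

text \<open>Membership in \<open>\<F>\<^sub>1\<close>, and membership of the shift in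
  \<open>\<T>\<^sub>1\<close>, are each tested against the other class of the pair. In this form
  closure properties of \<open>\<A>\<close> reduce to Hom lemmas on triangles.\<close>

lemma A_iff:
  "X \<in> \<A> \<longleftrightarrow> X \<in> Obj D \<and> (\<forall>T \<in> \<T>\<^sub>1. orth T X) \<and> (\<forall>F \<in> \<F>\<^sub>1. orth (Sh D X) F)"
  using mem_unshift_image_iff[OF torsion_Obj(1)] F1_iff T1_iff torsion_Obj(2) Sh_Obj
  unfolding \<A>_def heart_def tors_shift_def by auto

lemma A_Obj: "\<A> \<subseteq> Obj D"
  using A_iff by blast

text \<open>That \<open>\<H>\<close> lies in \<open>\<A>\<close> is the inclusion
  \<open>Sh_T2\<close>; what distinguishes \<open>\<H>\<close> is then membership in
  \<open>\<T>\<^sub>2\<close>, tested against \<open>\<F>\<^sub>2\<close>.\<close>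

lemma H_iff: "X \<in> \<H> \<longleftrightarrow> X \<in> \<A> \<and> (\<forall>F \<in> \<F>\<^sub>2. orth X F)"
proof -
  have H: "X \<in> \<H> \<longleftrightarrow> X \<in> \<F>\<^sub>1 \<and> X \<in> \<T>\<^sub>2" by (simp add: \<H>_def heart_def)
  have A: "X \<in> \<A> \<longleftrightarrow> X \<in> \<F>\<^sub>1 \<and> X \<in> Obj D \<and> Sh D X \<in> \<T>\<^sub>1"
    by (simp add: \<A>_def heart_def tors_shift_def mem_unshift_image_iff[OF torsion_Obj(1)])
  show ?thesis
  proof (cases "X \<in> Obj D")
    case True
    show ?thesis unfolding H A T2_iff[OF True, symmetric] using True Sh_T2[of X] by blast
  next
    case False
    then show ?thesis unfolding H A using torsion_Obj(3) by blast
  qed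
qed

lemma H_subset_A: "\<H> \<subseteq> \<A>"
  using H_iff by blast

lemma H_Obj: "\<H> \<subseteq> Obj D"
  using H_subset_A A_Obj by blast

lemma K_iff: "X \<in> \<K> \<longleftrightarrow> X \<in> \<A> \<and> X \<in> \<F>\<^sub>2"
  using F2_subset_F1 unfolding \<A>_def \<K>_def heart_def by auto

text \<open>\<open>Sh D X\<close> is torsion and \<open>Y\<close> torsion-free for the first pair.
  This vanishing of negative extensions supplies the shifted hypotheses of \<open>Tri_mono\<close>
  and its relatives.\<close>

lemma A_Sh_orth: "\<lbrakk>X \<in> \<A>; Y \<in> \<A>\<rbrakk> \<Longrightarrow> orth (Sh D X) Y"
  unfolding A_iff using T1_iff Sh_Obj by blast

lemma A_extension:
  assumes T: "Tri D X Y Z f g h" and XZ: "X \<in> \<A>" "Z \<in> \<A>"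
  shows "Y \<in> \<A>"
proof -
  obtain f' g' h' where T': "Tri D (Sh D X) (Sh D Y) (Sh D Z) f' g' h'"
    using Tri_Sh[OF T] by blast
  show ?thesis
    using XZ Tri_orth_middle_right[OF T] Tri_orth_middle_left[OF T'] Tri_typed[OF T] torsion_Obj
    unfolding A_iff by blast
qed

lemma A_zero: "zero_object D Z \<Longrightarrow> Z \<in> \<A>"
  unfolding A_iff
proof (intro conjI ballI)
  assume Z: "zero_object D Z"
  then show "Z \<in> Obj D" by (simp add: zero_object_def)
  show "orth T Z" if "T \<in> \<T>\<^sub>1" for T
    using orth_zero_object(2)[OF Z] that torsion_Obj(1) by blast
  show "orth (Sh D Z) F" if "F \<in> \<F>\<^sub>1" for F
    using orth_zero_object(1)[OF zero_object_Sh[OF Z]] that torsion_Obj(2) by blast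
qed

text \<open>Maps from \<open>Z\<close> to \<open>F\<close> lie between maps from \<open>Y\<close>,
  zero as \<open>Y\<close> is in \<open>\<H>\<close>, and maps from \<open>Sh D X\<close>, zero as
  \<open>F\<close> is also in \<open>\<F>\<^sub>1\<close>.\<close>

lemma H_quotient:
  assumes T: "Tri D X Y Z f g h" and XYZ: "X \<in> \<A>" "Y \<in> \<H>" "Z \<in> \<A>"
  shows "Z \<in> \<H>"
proof -
  have "orth Z F" if F: "F \<in> \<F>\<^sub>2" for F
  proof (rule Tri_orth_third_left[OF T])
    show "F \<in> Obj D" using F torsion_Obj(4) by blast
    show "orth Y F" using XYZ(2) F by (simp add: H_iff)
    show "orth (Sh D X) F" using XYZ(1) F F2_subset_F1 A_iff by blast
  qed
  then show ?thesis using XYZ(3) by (simp add: H_iff)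
qed

lemma H_iso_closed: "iso_closed_in D \<A> \<H>"
  unfolding iso_closed_in_def
proof (intro conjI ballI impI)
  fix A B assume A: "A \<in> \<H>" and B: "B \<in> \<A>" and AB: "isomorphic D A B"
  have o: "A \<in> Obj D" "B \<in> Obj D" using A B A_Obj H_subset_A by blast+
  have "orth B F" if F: "F \<in> \<F>\<^sub>2" for F
    using orth_iso_left[OF o _ AB] F A torsion_Obj(4) H_iff by blast
  then show "B \<in> \<H>" using B by (simp add: H_iff)
qed (rule H_subset_A)

text \<open>The decomposition of \<open>X\<close> for the second pair already has its outer terms in
  \<open>\<A>\<close>: each missing vanishing condition follows from the one for \<open>X\<close>
  and from \<open>Sh_T2\<close>.\<close>

lemma A_decomposition:
  assumes X: "X \<in> \<A>"
  obtains T F f g h where "T \<in> \<H>" "F \<in> \<K>" "Tri D T X F f g h"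
proof -
  have XO: "X \<in> Obj D" using X A_Obj by blast
  obtain T F f g h where TF: "T \<in> \<T>\<^sub>2" "F \<in> \<F>\<^sub>2" and tri: "Tri D T X F f g h"
    using storsD(7)[OF t2 subset_refl XO] by blast
  have o: "T \<in> Obj D" "F \<in> Obj D" using TF torsion_Obj by blast+
  have ShT: "Sh D T \<in> \<T>\<^sub>1" using Sh_T2 TF(1) .
  have "orth S T" if S: "S \<in> \<T>\<^sub>1" for S
  proof (rule Tri_orth_first_right[OF tri])
    show "S \<in> Obj D" using S torsion_Obj by blast
    show "orth S X" using S X A_iff by blast
    have "Sh D S \<in> \<T>\<^sub>1" using S Sh_T2 T1_subset_T2 by blast
    then show "orth (Sh D S) F" using storsD(5)[OF t1 subset_refl] F2_subset_F1 TF(2) by blast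
  qed
  then have "T \<in> \<A>" unfolding A_iff using o T1_iff[of "Sh D T"] Sh_Obj ShT by blast
  moreover have "\<forall>B \<in> \<F>\<^sub>2. orth T B" using TF(1) storsD(5)[OF t2 subset_refl] by blast
  ultimately have "T \<in> \<H>" unfolding H_iff by blast
  obtain f' g' h' where tri': "Tri D (Sh D T) (Sh D X) (Sh D F) f' g' h'"
    using Tri_Sh[OF tri] by blast
  have "orth (Sh D F) B" if B: "B \<in> \<F>\<^sub>1" for B
  proof (rule Tri_orth_third_left[OF tri'])
    show "B \<in> Obj D" using B torsion_Obj by blast
    show "orth (Sh D X) B" using B X A_iff by blast
    \<comment> \<open>The first shift moves \<open>T\<close> into \<open>\<T>\<^sub>1\<close>, which
      lies in \<open>\<T>\<^sub>2\<close>, so a second shift stays in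
      \<open>\<T>\<^sub>1\<close>.\<close>
    show "orth (Sh D (Sh D T)) B"
      using ShT Sh_T2 T1_subset_T2 storsD(5)[OF t1 subset_refl _ B] by blast
  qed
  then have "F \<in> \<A>"
    unfolding A_iff using o TF(2) F2_subset_F1 F1_iff by blast
  then have "F \<in> \<K>" using TF(2) K_iff by blast
  show thesis by (rule that) fact+
qed

lemma H_K_orth: "\<lbrakk>X \<in> \<H>; F \<in> \<K>\<rbrakk> \<Longrightarrow> orth X F"
  using H_iff K_iff by blast

text \<open>A coproduct in \<open>\<A>\<close> of objects of \<open>\<H>\<close> has only zero maps
  to its part in \<open>\<K>\<close>, so it lies in \<open>\<H>\<close>. Conversely, maps from
  \<open>\<H>\<close> to \<open>Y\<close> in \<open>\<A>\<close> factor uniquely through the part of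
  \<open>Y\<close> in \<open>\<H>\<close>, so the universal property tested on \<open>\<H>\<close>
  extends to \<open>\<A>\<close>.\<close>

lemma coproduct_H_iff_A:
  assumes W: "\<And>i. i \<in> \<alpha> \<Longrightarrow> W i \<in> \<H>"
  shows "is_coproduct D \<A> \<alpha> W P \<iota> \<longleftrightarrow> is_coproduct D \<H> \<alpha> W P \<iota>"
proof
  assume cop: "is_coproduct D \<A> \<alpha> W P \<iota>"
  then have P: "P \<in> \<A>" by (simp add: is_coproduct_def)
  obtain T F f g h where TF: "T \<in> \<H>" "F \<in> \<K>" and tri: "Tri D T P F f g h"
    using A_decomposition[OF P] .
  have F: "F \<in> \<A>" using TF(2) K_iff by blast
  have "orth P F"
    by (rule coproduct_orth[OF cop A_Obj F]) (rule H_K_orth[OF W TF(2)])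
  then have "zero_object D F"
    using Tri_second_zero_imp_third_zero[OF tri A_Sh_orth] TF H_subset_A F by blast
  then have "isomorphic D T P" by (rule Tri_third_zero_iso[OF tri])
  then have "P \<in> \<H>" using H_iso_closed TF(1) P unfolding iso_closed_in_def by blast
  then show "is_coproduct D \<H> \<alpha> W P \<iota>"
    using cop W H_subset_A unfolding is_coproduct_def by blast
next
  assume cop: "is_coproduct D \<H> \<alpha> W P \<iota>"
  then have P: "P \<in> \<H>" and io: "\<And>i. i \<in> \<alpha> \<Longrightarrow> \<iota> i \<in> Hom D (W i) P"
    by (auto simp: is_coproduct_def)
  have o: "P \<in> Obj D" "\<And>i. i \<in> \<alpha> \<Longrightarrow> W i \<in> Obj D" using P W H_Obj by blast+
  have "\<exists>!u. u \<in> Hom D P Y \<and> (\<forall>i \<in> \<alpha>. u \<bullet> \<iota> i = g i)"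
    if Y: "Y \<in> \<A>" and g: "\<forall>i \<in> \<alpha>. g i \<in> Hom D (W i) Y" for Y g
  proof -
    obtain T F f p h where TF: "T \<in> \<H>" "F \<in> \<K>" and tri: "Tri D T Y F f p h"
      using A_decomposition[OF Y] .
    have t: "T \<in> Obj D" "Y \<in> Obj D" "F \<in> Obj D" "f \<in> Hom D T Y" "p \<in> Hom D Y F"
      using Tri_typed[OF tri] by auto
    have lift: "\<exists>c \<in> Hom D X T. x = f \<bullet> c" if X: "X \<in> \<H>" "x \<in> Hom D X Y" for X x
    proof -
      have XO: "X \<in> Obj D" using X H_Obj by blast
      show ?thesis
        using Tri_lift[OF tri XO X(2)] orthD[OF H_K_orth[OF X(1) TF(2)]]
          Comp_in_Hom[OF XO t(2,3) X(2) t(5)] by blast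
    qed
    have "\<forall>i \<in> \<alpha>. \<exists>c. c \<in> Hom D (W i) T \<and> g i = f \<bullet> c" using lift W g by blast
    then obtain c where c: "\<And>i. i \<in> \<alpha> \<Longrightarrow> c i \<in> Hom D (W i) T" "\<And>i. i \<in> \<alpha> \<Longrightarrow> g i = f \<bullet> c i"
      by metis
    have "\<exists>!u. u \<in> Hom D P T \<and> (\<forall>i \<in> \<alpha>. u \<bullet> \<iota> i = c i)"
      using cop TF(1) c(1) by (simp add: is_coproduct_def)
    then obtain u where u: "u \<in> Hom D P T" "\<And>i. i \<in> \<alpha> \<Longrightarrow> u \<bullet> \<iota> i = c i" by blast
    have ex: "f \<bullet> u \<in> Hom D P Y \<and> (\<forall>i \<in> \<alpha>. (f \<bullet> u) \<bullet> \<iota> i = g i)"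
      using Comp_in_Hom[OF o(1) t(1,2) u(1) t(4)] Comp_assoc[OF o(2,1) t(1,2) io u(1) t(4)] u(2) c(2)
      by simp
    have "v = w"
      if v: "v \<in> Hom D P Y" "\<forall>i \<in> \<alpha>. v \<bullet> \<iota> i = g i"
        and w: "w \<in> Hom D P Y" "\<forall>i \<in> \<alpha>. w \<bullet> \<iota> i = g i" for v w
    proof -
      obtain v' w' where v': "v' \<in> Hom D P T" "v = f \<bullet> v'" and w': "w' \<in> Hom D P T" "w = f \<bullet> w'"
        using lift P v(1) w(1) by meson
      have "v' = w'"
      proof (rule coproduct_eq[OF cop H_Obj TF(1) v'(1) w'(1)])
        fix i assume i: "i \<in> \<alpha>"
        have "orth (Sh D (W i)) F" using A_Sh_orth W[OF i] TF(2) H_subset_A K_iff by blast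
        moreover have "f \<bullet> (v' \<bullet> \<iota> i) = f \<bullet> (w' \<bullet> \<iota> i)"
          using Comp_assoc[OF o(2)[OF i] o(1) t(1,2) io[OF i] _ t(4)] v' w' v(2) w(2) i by simp
        ultimately show "v' \<bullet> \<iota> i = w' \<bullet> \<iota> i"
          using Tri_mono[OF tri o(2)[OF i]] Comp_in_Hom[OF o(2)[OF i] o(1) t(1) io[OF i]] v'(1) w'(1)
          by blast
      qed
      then show ?thesis using v'(2) w'(2) by simp
    qed
    then show ?thesis using ex by blast
  qed
  then show "is_coproduct D \<A> \<alpha> W P \<iota>"
    using P W io H_subset_A unfolding is_coproduct_def by blast
qed

end

section \<open>Independence of \<open>Gen\<close>, \<open>Pres\<close> and \<open>Gen_bar\<close>
  from the choice of heart\<close>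

locale torsion_interval_object = torsion_interval D \<T>\<^sub>1 \<F>\<^sub>1 \<T>\<^sub>2 \<F>\<^sub>2
  for D :: "('o, 'm, 'z) triangulated_category_scheme" (structure)
    and \<T>\<^sub>1 \<F>\<^sub>1 \<T>\<^sub>2 \<F>\<^sub>2 +
  fixes V
  assumes V: "V \<in> \<H>"
    and Gen_bar_A_subset_H: "Gen_bar D \<A> V \<subseteq> \<H>"
begin

lemma V_Obj: "V \<in> Obj D"
  using V H_Obj by blast

text \<open>The conflation is the one with zero kernel and the identity of \<open>P\<close>, which
  is nonzero unless \<open>P\<close> is a zero object.\<close>

lemma copower_in_Gen:
  fixes \<alpha> :: "'m set"
  assumes cop: "is_coproduct D \<A> \<alpha> (\<lambda>_. V) P \<iota>"
  shows "P \<in> Gen D \<A> V"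
proof -
  have P: "P \<in> \<A>" using cop by (simp add: is_coproduct_def)
  then have PO: "P \<in> Obj D" using A_Obj by blast
  obtain Z where Z: "zero_object D Z" using ex_zero_object by blast
  have "copower_conflation D \<A> V Z P" if "\<not> zero_object D P"
  proof -
    have "Ide D P \<noteq> Zero D P P" using zero_objectI[OF PO] that by blast
    moreover have "conflation D \<A> Z P P (Zero D Z P) (Ide D P)"
      using Tri_Zero_Id[OF PO Z] A_zero[OF Z] P unfolding conflation_def by blast
    ultimately show ?thesis using cop unfolding copower_conflation_def by blast
  qed
  then show ?thesis using P unfolding Gen_def by blast
qed

lemma copower_conflation_H_iff_A:
  "copower_conflation D \<A> V K X \<longleftrightarrow> copower_conflation D \<H> V K X"
proof
  assume "copower_conflation D \<A> V K X"
  then obtain \<alpha> :: "'m set" and P \<iota> k f where cop: "is_coproduct D \<A> \<alpha> (\<lambda>_. V) P \<iota>"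
    and con: "conflation D \<A> K P X k f" and f: "f \<noteq> Zero D P X"
    unfolding copower_conflation_def by blast
  have cop': "is_coproduct D \<H> \<alpha> (\<lambda>_. V) P \<iota>"
    using cop coproduct_H_iff_A[of \<alpha> "\<lambda>_. V" P \<iota>] V by simp
  \<comment> \<open>The conflation starts at \<open>K\<close> and its middle term \<open>P\<close>
    is in \<open>Gen\<close>, so the hypothesis on \<open>Gen_bar\<close> applies to the
    kernel.\<close>
  have "K \<in> Gen_bar D \<A> V"
    using con copower_in_Gen[OF cop] unfolding Gen_bar_def conflation_def by blast
  then have K: "K \<in> \<H>" using Gen_bar_A_subset_H by blast
  have P: "P \<in> \<H>" using cop' by (simp add: is_coproduct_def)
  obtain h where T: "Tri D K P X k f h" and KX: "K \<in> \<A>" "X \<in> \<A>"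
    using con unfolding conflation_def by blast
  have "X \<in> \<H>" by (rule H_quotient[OF T KX(1) P KX(2)])
  then have "conflation D \<H> K P X k f" using K P T unfolding conflation_def by blast
  then show "copower_conflation D \<H> V K X"
    using cop' f unfolding copower_conflation_def by blast
next
  assume "copower_conflation D \<H> V K X"
  then obtain \<alpha> :: "'m set" and P \<iota> k f where cop: "is_coproduct D \<H> \<alpha> (\<lambda>_. V) P \<iota>"
    and con: "conflation D \<H> K P X k f" and f: "f \<noteq> Zero D P X"
    unfolding copower_conflation_def by blast
  have "is_coproduct D \<A> \<alpha> (\<lambda>_. V) P \<iota>"
    using cop coproduct_H_iff_A[of \<alpha> "\<lambda>_. V" P \<iota>] V by simp
  moreover have "conflation D \<A> K P X k f"
    using con H_subset_A unfolding conflation_def by blast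
  ultimately show "copower_conflation D \<A> V K X"
    using f unfolding copower_conflation_def by blast
qed

lemma copower_conflation_H_mem:
  assumes "copower_conflation D \<H> V K X"
  shows "K \<in> \<H>" "X \<in> \<H>"
  using assms unfolding copower_conflation_def conflation_def by blast+

lemma zero_object_H:
  assumes Z: "zero_object D Z"
  shows "Z \<in> \<H>"
proof -
  have "orth Z F" if "F \<in> \<F>\<^sub>2" for F
    using orth_zero_object(1)[OF Z] that torsion_Obj(4) by blast
  then show ?thesis using A_zero[OF Z] by (simp add: H_iff)
qed

lemma Gen_A_eq_H: "Gen D \<A> V = Gen D \<H> V"
  unfolding Gen_def copower_conflation_H_iff_A
  using copower_conflation_H_mem zero_object_H H_subset_A by blast

lemma Pres_A_eq_H: "Pres D \<A> V = Pres D \<H> V"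
  unfolding Pres_def copower_conflation_H_iff_A Gen_A_eq_H
  using copower_conflation_H_mem zero_object_H H_subset_A by blast

lemma Gen_H: "Gen D \<H> V \<subseteq> \<H>"
  by (auto simp: Gen_def)

lemma Gen_bar_A_eq_H: "Gen_bar D \<A> V = Gen_bar D \<H> V"
proof
  show "Gen_bar D \<A> V \<subseteq> Gen_bar D \<H> V"
  proof
    fix X assume X: "X \<in> Gen_bar D \<A> V"
    then obtain V0 X' f g h where V0: "V0 \<in> Gen D \<H> V" and T: "Tri D X V0 X' f g h"
      and XX: "X \<in> \<A>" "X' \<in> \<A>"
      unfolding Gen_bar_def conflation_def Gen_A_eq_H by blast
    have "V0 \<in> \<H>" using V0 Gen_H by blast
    moreover from this have "X' \<in> \<H>" using H_quotient[OF T XX(1) _ XX(2)] by blast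
    moreover have "X \<in> \<H>" using X Gen_bar_A_subset_H by blast
    ultimately show "X \<in> Gen_bar D \<H> V"
      using V0 T unfolding Gen_bar_def conflation_def by blast
  qed
  show "Gen_bar D \<H> V \<subseteq> Gen_bar D \<A> V"
    using H_subset_A unfolding Gen_bar_def conflation_def Gen_A_eq_H by blast
qed

text \<open>The identity triangle embeds \<open>X\<close> in itself with zero cokernel.\<close>

lemma Gen_subset_Gen_bar: "Gen D \<H> V \<subseteq> Gen_bar D \<H> V"
proof
  fix X assume X: "X \<in> Gen D \<H> V"
  obtain Z where Z: "zero_object D Z" using ex_zero_object by blast
  have "X \<in> Obj D" "X \<in> \<H>" using X Gen_H H_Obj by blast+
  then show "X \<in> Gen_bar D \<H> V"
    using X Tri_Id[OF _ Z] zero_object_H[OF Z] unfolding Gen_bar_def conflation_def by blast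
qed

section \<open>The torsion pairs defined by \<open>V\<close> in the two hearts\<close>

lemma perp_A_H: "perp D \<H> 0 V = perp D \<A> 0 V \<inter> \<H>"
  using H_subset_A by (auto simp: perp_def)

lemmas perp_A_iff = perp_iff[OF V_Obj A_Obj]
lemmas perp_H_iff = perp_iff[OF V_Obj H_Obj]

text \<open>Maps from \<open>X\<close> to \<open>Y\<close> lie between maps from the copower
  \<open>P\<close> and maps from \<open>Sh D K\<close>. The copower is taken in \<open>\<A>\<close>
  so that it can be tested on \<open>Y\<close>, which may lie outside \<open>\<H>\<close>.\<close>

lemma Gen_orth_perp:
  assumes X: "X \<in> Gen D \<H> V" and Y: "Y \<in> perp D \<A> 0 V"
  shows "orth X Y"
proof (cases "zero_object D X")
  case True
  then show ?thesis using orth_zero_object(1)[OF True] Y A_Obj perp_A_iff(1) by blast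
next
  case False
  have YA: "Y \<in> \<A>" "orth V Y" using Y by (simp_all add: perp_A_iff)
  obtain K where "copower_conflation D \<A> V K X"
    using X False unfolding Gen_def copower_conflation_H_iff_A by blast
  then obtain \<alpha> :: "'m set" and P \<iota> k f h where cop: "is_coproduct D \<A> \<alpha> (\<lambda>_. V) P \<iota>"
    and T: "Tri D K P X k f h" and K: "K \<in> \<A>"
    unfolding copower_conflation_def conflation_def by blast
  show ?thesis
    using Tri_orth_third_left[OF T _ coproduct_orth[OF cop A_Obj YA(1) YA(2)] A_Sh_orth[OF K YA(1)]]
      YA(1) A_Obj by blast
qed

lemma orth_K: "F \<in> \<K> \<Longrightarrow> orth V F"
  using H_K_orth V by blast

text \<open>For one inclusion decompose \<open>Y\<close>: maps from \<open>V\<close> to its part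
  \<open>T\<close> in \<open>\<H>\<close> lie between maps from \<open>V\<close> to \<open>Y\<close>
  and from \<open>Sh D V\<close> to \<open>F\<close>. The other combines extension closure of
  \<open>\<A>\<close> with the absence of nonzero maps from \<open>V\<close> to
  \<open>\<K>\<close>.\<close>

lemma perp_A_eq_star: "perp D \<A> 0 V = star D (Obj D) (perp D \<H> 0 V) \<K>"
proof (intro subset_antisym subsetI)
  fix Y assume "Y \<in> perp D \<A> 0 V"
  then have Y: "Y \<in> \<A>" "orth V Y" by (simp_all add: perp_A_iff)
  obtain T F f g h where TF: "T \<in> \<H>" "F \<in> \<K>" and tri: "Tri D T Y F f g h"
    using A_decomposition[OF Y(1)] .
  have "orth (Sh D V) F" using A_Sh_orth V H_subset_A TF(2) K_iff by blast
  then have "orth V T" by (rule Tri_orth_first_right[OF tri V_Obj Y(2)])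
  then have "T \<in> perp D \<H> 0 V" using TF(1) by (simp add: perp_H_iff)
  then show "Y \<in> star D (Obj D) (perp D \<H> 0 V) \<K>"
    using TF(2) tri Tri_typed[OF tri] unfolding star_def conflation_def by blast
next
  fix Y assume "Y \<in> star D (Obj D) (perp D \<H> 0 V) \<K>"
  then obtain T F f g h where T: "T \<in> perp D \<H> 0 V" and F: "F \<in> \<K>" and tri: "Tri D T Y F f g h"
    unfolding star_def conflation_def by blast
  have "T \<in> \<A>" "orth V T" using T H_subset_A by (auto simp: perp_H_iff)
  moreover have "F \<in> \<A>" using F by (simp add: K_iff)
  ultimately show "Y \<in> perp D \<A> 0 V"
    using A_extension[OF tri] Tri_orth_middle_right[OF tri V_Obj _ orth_K[OF F]]
    by (simp add: perp_A_iff)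
qed

text \<open>Decompositions restrict to \<open>\<H>\<close> because their last term is a quotient. To
  extend them to \<open>\<A>\<close>, the part of \<open>X\<close> in \<open>\<H>\<close> is
  decomposed again, and the two triangles are glued.\<close>

lemma stors_A_iff_H:
  "(Gen D \<A> V, perp D \<A> 0 V) \<in> stors D \<A> \<longleftrightarrow> (Gen D \<H> V, perp D \<H> 0 V) \<in> stors D \<H>"
proof
  assume t: "(Gen D \<A> V, perp D \<A> 0 V) \<in> stors D \<A>"
  show "(Gen D \<H> V, perp D \<H> 0 V) \<in> stors D \<H>"
  proof (rule storsI[OF H_Obj])
    show "iso_closed_in D \<H> (Gen D \<H> V)"
      using storsD(1)[OF t A_Obj] Gen_H H_subset_A unfolding iso_closed_in_def Gen_A_eq_H by blast
    show "iso_closed_in D \<H> (perp D \<H> 0 V)"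
      by (rule perp_iso_closed[OF V_Obj H_Obj])
    show "orth A B" "orth (Sh D A) B" if "A \<in> Gen D \<H> V" "B \<in> perp D \<H> 0 V" for A B
      using that storsD(5,6)[OF t A_Obj] by (auto simp: Gen_A_eq_H perp_A_H)
    fix C assume C: "C \<in> \<H>"
    then have CA: "C \<in> \<A>" using H_subset_A by blast
    obtain A B f g h where AB: "A \<in> Gen D \<H> V" "B \<in> perp D \<A> 0 V" and T: "Tri D A C B f g h"
      using storsD(7)[OF t A_Obj CA] unfolding Gen_A_eq_H by blast
    have "A \<in> \<A>" "B \<in> \<A>" using AB Gen_H H_subset_A by (auto simp: perp_A_iff)
    then have "B \<in> \<H>" using H_quotient[OF T _ C] by blast
    then show "\<exists>A \<in> Gen D \<H> V. \<exists>B \<in> perp D \<H> 0 V. \<exists>f g h. Tri D A C B f g h"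
      using AB T unfolding perp_A_H by blast
  qed
next
  assume t: "(Gen D \<H> V, perp D \<H> 0 V) \<in> stors D \<H>"
  have GenA: "Gen D \<H> V \<subseteq> \<A>" using Gen_H H_subset_A by blast
  show "(Gen D \<A> V, perp D \<A> 0 V) \<in> stors D \<A>"
    unfolding Gen_A_eq_H
  proof (rule storsI[OF A_Obj])
    show "iso_closed_in D \<A> (Gen D \<H> V)"
      using storsD(1)[OF t H_Obj] H_iso_closed GenA unfolding iso_closed_in_def by blast
    show "iso_closed_in D \<A> (perp D \<A> 0 V)"
      by (rule perp_iso_closed[OF V_Obj A_Obj])
    show "orth A B" if "A \<in> Gen D \<H> V" "B \<in> perp D \<A> 0 V" for A B
      by (rule Gen_orth_perp[OF that])
    show "orth (Sh D A) B" if "A \<in> Gen D \<H> V" "B \<in> perp D \<A> 0 V" for A B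
      using A_Sh_orth that GenA unfolding perp_A_iff by blast
    fix X assume X: "X \<in> \<A>"
    obtain T F f g h where TF: "T \<in> \<H>" "F \<in> \<K>" and T: "Tri D T X F f g h"
      using A_decomposition[OF X] .
    obtain G Y f' g' h' where GY: "G \<in> Gen D \<H> V" "Y \<in> perp D \<H> 0 V" and G: "Tri D G T Y f' g' h'"
      using storsD(7)[OF t H_Obj TF(1)] by blast
    have o: "G \<in> Obj D" "T \<in> Obj D" "X \<in> Obj D" "f' \<in> Hom D G T" "f \<in> Hom D T X"
      using Tri_typed[OF T] Tri_typed[OF G] by auto
    obtain Q w w' where Q: "Tri D G X Q (f \<bullet> f') w w'"
      using Tri_ex[OF o(1,3) Comp_in_Hom[OF o]] by blast
    \<comment> \<open>The octahedral axiom, applied to \<open>G\<close> to \<open>T\<close> to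
      \<open>X\<close>, exhibits the cone \<open>Q\<close> of the composite as an extension of
      \<open>F\<close> by \<open>Y\<close>, so \<open>perp_A_eq_star\<close> recognizes it.\<close>
    obtain a b c where YQF: "Tri D Y Q F a b c"
      using Tri_octahedral[OF G T Q] by blast
    have "Q \<in> star D (Obj D) (perp D \<H> 0 V) \<K>"
      using YQF GY(2) TF(2) Tri_typed[OF YQF] unfolding star_def conflation_def by blast
    then have "Q \<in> perp D \<A> 0 V" by (simp only: perp_A_eq_star)
    then show "\<exists>A \<in> Gen D \<H> V. \<exists>B \<in> perp D \<A> 0 V. \<exists>f g h. Tri D A X B f g h"
      using GY(1) Q by blast
  qed
qed

section \<open>Comparison of extended tilting and quasi-tilting objects\<close>

lemma Gen_bar_perp1_subset_Gen:
  assumes t: "(Gen D \<H> V, perp D \<H> 0 V) \<in> stors D \<H>"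
    and pres: "Gen D \<H> V = Pres D \<H> V"
    and X: "X \<in> Gen_bar D \<H> V" "orth V (Sh D X)"
  shows "X \<in> Gen D \<H> V"
proof -
  obtain V0 X' f g d where V0: "V0 \<in> Gen D \<H> V" and T: "Tri D X V0 X' f g d"
    and XH: "X \<in> \<H>" "X' \<in> \<H>"
    using X(1) unfolding Gen_bar_def conflation_def by blast
  have V0H: "V0 \<in> \<H>" using V0 Gen_H by blast
  have o: "X \<in> Obj D" "V0 \<in> Obj D" "X' \<in> Obj D" "f \<in> Hom D X V0" "g \<in> Hom D V0 X'"
    "d \<in> Hom D X' (Sh D X)"
    using Tri_typed[OF T] by auto
  note SX = Sh_Obj[OF o(1)]
  have "orth X Y" if Y: "Y \<in> perp D \<H> 0 V" for Y
    unfolding orth_def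
  proof
    fix y assume y: "y \<in> Hom D X Y"
    have YH: "Y \<in> \<H>" "Y \<in> Obj D" using Y H_Obj by (auto simp: perp_H_iff)
    note SY = Sh_Obj[OF YH(2)]
    note Sy = Shm_Hom[OF o(1) YH(2) y]
    have V0Y: "orth V0 Y" using storsD(5)[OF t H_Obj V0 Y] .
    \<comment> \<open>As a quotient of \<open>V0\<close>, \<open>X'\<close> is orthogonal to the
      torsion-free class; being in \<open>Gen\<close>, it has a presentation whose kernel is again
      in \<open>Gen\<close>.\<close>
    have "X' \<in> Gen D \<H> V"
    proof -
      have "orth X' B" if B: "B \<in> perp D \<H> 0 V" for B
      proof (rule Tri_orth_third_left[OF T])
        have BH: "B \<in> \<H>" using B by (simp add: perp_H_iff)
        show "B \<in> Obj D" using BH H_Obj by blast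
        show "orth V0 B" using storsD(5)[OF t H_Obj V0 B] .
        show "orth (Sh D X) B" using A_Sh_orth XH(1) BH H_subset_A by blast
      qed
      then show ?thesis using stors_mem_fst_iff[OF t H_Obj XH(2)] by blast
    qed
    then have X': "X' \<in> Pres D \<H> V" using pres by blast
    have "Shm D y \<bullet> d = Zero D X' (Sh D Y)"
    proof (cases "zero_object D X'")
      case True
      show ?thesis
        using orthD[OF orth_zero_object(1)[OF True SY] Comp_in_Hom[OF o(3) SX SY o(6) Sy]] .
    next
      case False
      then obtain K where K: "K \<in> Gen D \<H> V" "copower_conflation D \<H> V K X'"
        using X' unfolding Pres_def by blast
      then obtain \<alpha> :: "'m set" and P \<iota> k p e where cop: "is_coproduct D \<H> \<alpha> (\<lambda>_. V) P \<iota>"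
        and TP: "Tri D K P X' k p e"
        unfolding copower_conflation_def conflation_def by blast
      have io: "\<And>i. i \<in> \<alpha> \<Longrightarrow> \<iota> i \<in> Hom D V P" using cop by (simp add: is_coproduct_def)
      have oP: "K \<in> Obj D" "P \<in> Obj D" "p \<in> Hom D P X'" "e \<in> Hom D X' (Sh D K)"
        using Tri_typed[OF TP] by auto
      have pi: "p \<bullet> \<iota> i \<in> Hom D V X'" if "i \<in> \<alpha>" for i
        using Comp_in_Hom[OF V_Obj oP(2) o(3) io[OF that] oP(3)] .
      txt \<open>
        The shift of \<open>X\<close> lies outside the heart, so the coproduct property of \<open>P\<close>
        cannot be tested on it directly; instead \<open>p\<close> is lifted through \<open>g\<close>.
      \<close>
      have "\<exists>c. c \<in> Hom D V V0 \<and> p \<bullet> \<iota> i = g \<bullet> c" if i: "i \<in> \<alpha>" for i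
        using Tri_lift_connecting[OF T V_Obj pi[OF i]] orthD[OF X(2)]
          Comp_in_Hom[OF V_Obj o(3) SX pi[OF i] o(6)] by blast
      then obtain c where c: "\<And>i. i \<in> \<alpha> \<Longrightarrow> c i \<in> Hom D V V0"
        "\<And>i. i \<in> \<alpha> \<Longrightarrow> p \<bullet> \<iota> i = g \<bullet> c i" by metis
      have "\<exists>!u. u \<in> Hom D P V0 \<and> (\<forall>i \<in> \<alpha>. u \<bullet> \<iota> i = c i)"
        using cop V0H c(1) by (simp add: is_coproduct_def)
      then obtain u where u: "u \<in> Hom D P V0" "\<And>i. i \<in> \<alpha> \<Longrightarrow> u \<bullet> \<iota> i = c i" by blast
      \<comment> \<open>Both maps end in \<open>X'\<close>, which lies in \<open>\<H>\<close>, so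
        they may be compared on the coproduct injections.\<close>
      have "p = g \<bullet> u"
      proof (rule coproduct_eq[OF cop H_Obj XH(2) oP(3) Comp_in_Hom[OF oP(2) o(2,3) u(1) o(5)]])
        fix i assume i: "i \<in> \<alpha>"
        show "p \<bullet> \<iota> i = (g \<bullet> u) \<bullet> \<iota> i"
          using Comp_assoc[OF V_Obj oP(2) o(2,3) io[OF i] u(1) o(5)] u(2)[OF i] c(2)[OF i] by simp
      qed
      \<comment> \<open>As \<open>d\<close> kills \<open>g\<close>, it also kills \<open>p\<close>,
        and therefore factors through the connecting map \<open>e\<close> of the
        presentation.\<close>
      then have "d \<bullet> p = (d \<bullet> g) \<bullet> u"
        using Comp_assoc[OF oP(2) o(2,3) SX u(1) o(5,6)] by simp
      also have "\<dots> = Zero D P (Sh D X)"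
        using Tri_Comp_Zero[OF Tri_rotateI[OF T]] Zero_Comp[OF oP(2) o(2) SX u(1)] by simp
      finally obtain r where r: "r \<in> Hom D (Sh D K) (Sh D X)" "d = r \<bullet> e"
        using Tri_factor_connecting[OF TP SX o(6)] by blast
      note SK = Sh_Obj[OF oP(1)]
      \<comment> \<open>This is where the kernel \<open>K\<close> must be in \<open>Gen\<close>: it
        is then orthogonal to \<open>Y\<close>.\<close>
      have "orth (Sh D K) (Sh D Y)"
        using storsD(5)[OF t H_Obj K(1) Y] orth_Sh_iff[OF oP(1) YH(2)] by blast
      then have "Shm D y \<bullet> r = Zero D (Sh D K) (Sh D Y)"
        using orthD Comp_in_Hom[OF SK SX SY r(1) Sy] by blast
      then show ?thesis
        using r(2) Comp_assoc[OF o(3) SK SX SY oP(4) r(1) Sy] Zero_Comp[OF o(3) SK SY oP(4)] by simp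
    qed
    then show "y = Zero D X Y" by (rule Tri_extend_zero[OF T YH(2) V0Y y])
  qed
  then show ?thesis using stors_mem_fst_iff[OF t H_Obj XH(1)] by blast
qed

text \<open>This trades the cogenerating condition of extended tilting for the equality that
  accompanies quasi-tilting.\<close>

lemma cogenerating_iff: "cogenerating D \<H> (Gen D \<H> V) \<longleftrightarrow> Gen_bar D \<H> V = \<H>"
  using Gen_H unfolding cogenerating_def Gen_bar_def by blast

lemma extended_tilting_iff_quasi_tilting:
  "extended_tilting D \<H> V \<longleftrightarrow> quasi_tilting D \<A> V \<and> Gen_bar D \<A> V = \<H>"
proof
  assume ext: "extended_tilting D \<H> V"
  have t: "(Gen D \<H> V, perp D \<H> 0 V) \<in> stors D \<H>" and pres: "Gen D \<H> V = Pres D \<H> V"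
    and perp1: "Gen D \<H> V \<subseteq> perp D \<H> 1 V" and bar: "Gen_bar D \<H> V = \<H>"
    using ext unfolding extended_tilting_def cogenerating_iff by blast+
  \<comment> \<open>On members of \<open>\<H>\<close> the two degree 1 perpendicular classes agree,
    since the Ext groups do not depend on the heart.\<close>
  have "Gen D \<H> V = Gen_bar D \<H> V \<inter> perp D \<A> 1 V"
  proof (intro subset_antisym subsetI IntI)
    fix X assume X: "X \<in> Gen D \<H> V"
    then show "X \<in> Gen_bar D \<H> V" using Gen_subset_Gen_bar by blast
    have "X \<in> perp D \<H> 1 V" using X perp1 by blast
    then show "X \<in> perp D \<A> 1 V" using H_subset_A by (auto simp: perp_def)
  next
    fix X assume "X \<in> Gen_bar D \<H> V \<inter> perp D \<A> 1 V"
    then show "X \<in> Gen D \<H> V"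
      using Gen_bar_perp1_subset_Gen[OF t pres] by (simp add: perp_A_iff)
  qed
  moreover have "V \<in> \<A>" using V H_subset_A by blast
  moreover have "(Gen D \<H> V, perp D \<A> 0 V) \<in> stors D \<A>"
    using t stors_A_iff_H by (simp add: Gen_A_eq_H)
  ultimately show "quasi_tilting D \<A> V \<and> Gen_bar D \<A> V = \<H>"
    using pres bar unfolding quasi_tilting_def Gen_A_eq_H Pres_A_eq_H Gen_bar_A_eq_H by simp
next
  assume quasi: "quasi_tilting D \<A> V \<and> Gen_bar D \<A> V = \<H>"
  have t: "(Gen D \<A> V, perp D \<A> 0 V) \<in> stors D \<A>"
    using quasi unfolding quasi_tilting_def by blast
  have pres: "Gen D \<H> V = Pres D \<H> V" "Pres D \<H> V = Gen_bar D \<H> V \<inter> perp D \<A> 1 V"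
    and bar: "Gen_bar D \<H> V = \<H>"
    using quasi unfolding quasi_tilting_def Gen_A_eq_H Pres_A_eq_H Gen_bar_A_eq_H by blast+
  \<comment> \<open>The degree 1 vanishing is read off from the intersection, and \<open>bar\<close>
    supplies membership in \<open>\<H>\<close>.\<close>
  have "Gen D \<H> V \<subseteq> perp D \<H> 1 V"
    using pres bar by (auto simp: perp_def)
  then show "extended_tilting D \<H> V"
    using V t pres(1) bar stors_A_iff_H unfolding extended_tilting_def cogenerating_iff by blast
qed

end

theorem theorem5p19:
  fixes D :: "('o, 'm) triangulated_category"
    and t\<^sub>1 t\<^sub>2 :: "'o set \<times> 'o set"
    and V :: 'o
  assumes "triangulated_category D"
    and "t\<^sub>1 \<in> stors D (Obj D)" and "t\<^sub>2 \<in> stors D (Obj D)"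
    and "tors_le t\<^sub>1 t\<^sub>2" and "tors_le t\<^sub>2 (tors_shift D (-1) t\<^sub>1)"
    and "V \<in> heart t\<^sub>1 t\<^sub>2"
    and "Gen_bar D (heart t\<^sub>1 (tors_shift D (-1) t\<^sub>1)) V \<subseteq> heart t\<^sub>1 t\<^sub>2"
  shows "(extended_tilting D (heart t\<^sub>1 t\<^sub>2) V \<longleftrightarrow>
          quasi_tilting D (heart t\<^sub>1 (tors_shift D (-1) t\<^sub>1)) V \<and>
          Gen_bar D (heart t\<^sub>1 (tors_shift D (-1) t\<^sub>1)) V = heart t\<^sub>1 t\<^sub>2) \<and>
         (extended_tilting D (heart t\<^sub>1 t\<^sub>2) V \<or>
          quasi_tilting D (heart t\<^sub>1 (tors_shift D (-1) t\<^sub>1)) V \<and>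
          Gen_bar D (heart t\<^sub>1 (tors_shift D (-1) t\<^sub>1)) V = heart t\<^sub>1 t\<^sub>2 \<longrightarrow>
          perp D (heart t\<^sub>1 (tors_shift D (-1) t\<^sub>1)) 0 V =
          star D (Obj D) (perp D (heart t\<^sub>1 t\<^sub>2) 0 V) (heart t\<^sub>2 (tors_shift D (-1) t\<^sub>1)))"
proof -
  interpret triangulated_category D by fact
  interpret I: torsion_interval D "fst t\<^sub>1" "snd t\<^sub>1" "fst t\<^sub>2" "snd t\<^sub>2"
    by unfold_locales (use assms(2-5) in simp_all)
  have hearts: "I.\<A> = heart t\<^sub>1 (tors_shift D (-1) t\<^sub>1)" "I.\<H> = heart t\<^sub>1 t\<^sub>2"
    "I.\<K> = heart t\<^sub>2 (tors_shift D (-1) t\<^sub>1)"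
    by (simp_all add: I.\<A>_def I.\<H>_def I.\<K>_def)
  \<comment> \<open>The assumptions of this locale mention \<open>\<A>\<close> and
    \<open>\<H>\<close>, so \<open>hearts\<close> is needed first to match them with the hypotheses
    on \<open>V\<close>.\<close>
  interpret torsion_interval_object D "fst t\<^sub>1" "snd t\<^sub>1" "fst t\<^sub>2" "snd t\<^sub>2" V
    by unfold_locales (use assms(6,7) in \<open>simp_all add: hearts\<close>)
  show ?thesis
    using extended_tilting_iff_quasi_tilting perp_A_eq_star unfolding hearts by blast
qed

end
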